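(* If $R$ is a non-discrete irreducible, continuous ring, then the topological group $\mathrm{GL}(R)$ (with the rank topology) does not admit any non-zero escape function.
   Context: All rings are unital. A ring $R$ is regular if for every $a \in R$ there is $b \in R$ with $aba=a$. For a regular ring $R$, the set $L(R)=\{aR : a\in R\}$, ordered by inclusion, is a complemented modular lattice. A continuous ring is a regular ring $R$ such that the lattice $L(R)$ is complete and satisfies $I\wedge\bigvee C=\bigvee\{I\wedge J : J\in C\}$ and $I\vee\bigwedge C=\bigwedge\{I\vee J : J\in C\}$ for every chain $C\subseteq L(R)$ and every $I\in L(R)$. A ring is irreducible if it is non-zero and not isomorphic to a direct product of two non-zero rings. A rank function on a regular ring $R$ is a map $\rho\colon R\to[0,1]$ with $\rho(1)=1$, $\rho(ab)\le\min\{\rho(a),\rho(b)\}$ for all $a,b \in R$, $\rho(e+f)=\rho(e)+\rho(f)$ for any idempotents $e,f$ with $ef=fe=0$, and $\rho(a)=0$ only if $a=0$. Every irreducible, continuous ring $R$ has a unique rank function, denoted $\mathrm{rk}_R$; the rank metric is $d_R(a,b)=\mathrm{rk}_R(a-b)$, and the topology it generates is the rank topology. $R$ is non-discrete if its rank topology is not discrete. $\mathrm{GL}(R)$ denotes the group of units of $R$, a topological group with the rank topology. A length function on a group $G$ is a map $f\colon G\to\mathbb{R}$ with $f(e)=0$, $f(x^{-1})=f(x)\ge0$ and $f(xy)\le f(x)+f(y)$ for all $x,y\in G$. For a topological group $G$, a neighborhood $U$ of the neutral element is an escape neighborhood for a length function $f$ on $G$ if for every $\varepsilon>0$ there is $n\in\mathbb{N}$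 such that $\{x\in G : x^1,\ldots,x^n\in U\}\subseteq f^{-1}([0,\varepsilon))$. An escape function on $G$ is a length function on $G$ possessing an escape neighborhood. *)

theory Defs
  imports "HOL-Analysis.Analysis" "HOL-Algebra.Algebra"
begin

definition regular_ring :: "('a, 'm) ring_scheme \<Rightarrow> bool" where
  "regular_ring R \<longleftrightarrow> ring R \<and>
     (\<forall>a\<in>carrier R. \<exists>b\<in>carrier R. a \<otimes>\<^bsub>R\<^esub> b \<otimes>\<^bsub>R\<^esub> a = a)"

text \<open>The left coset \<open>a <# carrier R\<close>, formed in the multiplicative monoid, is the principal
  right ideal \<open>aR\<close>.\<close>

definition principal_right_ideals :: "('a, 'm) ring_scheme \<Rightarrow> 'a set set" where
  "principal_right_ideals R = {a <#\<^bsub>R\<^esub> carrier R | a. a \<in> carrier R}"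

definition right_ideal_lattice :: "('a, 'm) ring_scheme \<Rightarrow> 'a set gorder" where
  "right_ideal_lattice R = \<lparr>carrier = principal_right_ideals R, eq = (=), le = (\<subseteq>)\<rparr>"

definition continuous_ring :: "('a, 'm) ring_scheme \<Rightarrow> bool" where
  "continuous_ring R \<longleftrightarrow>
     regular_ring R \<and>
     complete_lattice (right_ideal_lattice R) \<and>
     (\<forall>C I. subset.chain (principal_right_ideals R) C \<longrightarrow> I \<in> principal_right_ideals R \<longrightarrow>
        I \<sqinter>\<^bsub>right_ideal_lattice R\<^esub> \<Squnion>\<^bsub>right_ideal_lattice R\<^esub> C =
          \<Squnion>\<^bsub>right_ideal_lattice R\<^esub> {I \<sqinter>\<^bsub>right_ideal_lattice R\<^esub> J | J. J \<in> C} \<and>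
        I \<squnion>\<^bsub>right_ideal_lattice R\<^esub> \<Sqinter>\<^bsub>right_ideal_lattice R\<^esub> C =
          \<Sqinter>\<^bsub>right_ideal_lattice R\<^esub> {I \<squnion>\<^bsub>right_ideal_lattice R\<^esub> J | J. J \<in> C})"

text \<open>It suffices to let the two factors range over rings on the type of \<open>R\<close>: if \<open>R\<close> is isomorphic
  to a product of two rings over any types, each factor is isomorphic to a ring whose carrier
  is a subset of \<open>carrier R\<close>.\<close>

definition irreducible_ring :: "('a, 'm) ring_scheme \<Rightarrow> bool" where
  "irreducible_ring R \<longleftrightarrow> carrier R \<noteq> {\<zero>\<^bsub>R\<^esub>} \<and>
     \<not> (\<exists>(S :: 'a ring) (T :: 'a ring). ring S \<and> ring T \<and>
          carrier S \<noteq> {\<zero>\<^bsub>S\<^esub>} \<and> carrier T \<noteq> {\<zero>\<^bsub>T\<^esub>} \<and> R \<simeq> RDirProd S T)"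

text \<open>Rank functions are required to be extensional (\<open>undefined\<close> off the carrier), so that
  uniqueness of a rank function as a map on \<open>carrier R\<close> is uniqueness of a HOL function.\<close>

definition rank_function :: "('a, 'm) ring_scheme \<Rightarrow> ('a \<Rightarrow> real) \<Rightarrow> bool" where
  "rank_function R \<rho> \<longleftrightarrow>
     \<rho> \<in> carrier R \<rightarrow>\<^sub>E {0..1} \<and>
     \<rho> \<one>\<^bsub>R\<^esub> = 1 \<and>
     (\<forall>a\<in>carrier R. \<forall>b\<in>carrier R. \<rho> (a \<otimes>\<^bsub>R\<^esub> b) \<le> min (\<rho> a) (\<rho> b)) \<and>
     (\<forall>e\<in>carrier R. \<forall>f\<in>carrier R.
        e \<otimes>\<^bsub>R\<^esub> e = e \<longrightarrow> f \<otimes>\<^bsub>R\<^esub> f = f \<longrightarrow> e \<otimes>\<^bsub>R\<^esub> f = \<zero>\<^bsub>R\<^esub> \<longrightarrow> f \<otimes>\<^bsub>R\<^esub> e = \<zero>\<^bsub>R\<^esub> \<longrightarrow>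
        \<rho> (e \<oplus>\<^bsub>R\<^esub> f) = \<rho> e + \<rho> f) \<and>
     (\<forall>a\<in>carrier R. \<rho> a = 0 \<longrightarrow> a = \<zero>\<^bsub>R\<^esub>)"

text \<open>By a theorem of von Neumann an irreducible continuous ring has exactly one rank function;
  the default value \<open>0\<close> only makes the definition total on other rings.\<close>

definition rk :: "('a, 'm) ring_scheme \<Rightarrow> 'a \<Rightarrow> real" where
  "rk R = (if \<exists>!\<rho>. rank_function R \<rho> then THE \<rho>. rank_function R \<rho> else (\<lambda>_. 0))"

definition rank_dist :: "('a, 'm) ring_scheme \<Rightarrow> 'a \<Rightarrow> 'a \<Rightarrow> real" where
  "rank_dist R a b = rk R (a \<ominus>\<^bsub>R\<^esub> b)"

text \<open>Generated by the open balls. For an irreducible continuous ring this is the metric topology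
  of \<open>rank_dist\<close>; the locale \<open>Metric_space\<close> is not used because it asks for a nonnegative symmetric
  function on the whole type, not just on the carrier.\<close>

definition rank_topology :: "('a, 'm) ring_scheme \<Rightarrow> 'a topology" where
  "rank_topology R =
     topology_generated_by
       {{b \<in> carrier R. rank_dist R a b < \<epsilon>} | a \<epsilon>. a \<in> carrier R \<and> 0 < \<epsilon>}"

definition nondiscrete_ring :: "('a, 'm) ring_scheme \<Rightarrow> bool" where
  "nondiscrete_ring R \<longleftrightarrow> rank_topology R \<noteq> discrete_topology (carrier R)"

abbreviation GL :: "('a, 'm) ring_scheme \<Rightarrow> 'a monoid" where
  "GL R \<equiv> units_of R"

definition GL_topology :: "('a, 'm) ring_scheme \<Rightarrow> 'a topology" where
  "GL_topology R = subtopology (rank_topology R) (Units R)"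

definition length_function :: "('g, 'm) monoid_scheme \<Rightarrow> ('g \<Rightarrow> real) \<Rightarrow> bool" where
  "length_function G f \<longleftrightarrow>
     f \<one>\<^bsub>G\<^esub> = 0 \<and>
     (\<forall>x\<in>carrier G. f (inv\<^bsub>G\<^esub> x) = f x \<and> 0 \<le> f x) \<and>
     (\<forall>x\<in>carrier G. \<forall>y\<in>carrier G. f (x \<otimes>\<^bsub>G\<^esub> y) \<le> f x + f y)"

text \<open>Below, \<open>T\<close> is the topology of the topological group \<open>G\<close>; a neighbourhood need not be open.\<close>

definition escape_neighbourhood ::
  "('g, 'm) monoid_scheme \<Rightarrow> 'g topology \<Rightarrow> ('g \<Rightarrow> real) \<Rightarrow> 'g set \<Rightarrow> bool" where
  "escape_neighbourhood G T f U \<longleftrightarrow>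
     (\<exists>V. openin T V \<and> \<one>\<^bsub>G\<^esub> \<in> V \<and> V \<subseteq> U \<and> U \<subseteq> carrier G) \<and>
     (\<forall>\<epsilon>>0. \<exists>n::nat. \<forall>x\<in>carrier G. (\<forall>k\<in>{1..n}. x [^]\<^bsub>G\<^esub> k \<in> U) \<longrightarrow> f x \<in> {0..<\<epsilon>})"

definition escape_function ::
  "('g, 'm) monoid_scheme \<Rightarrow> 'g topology \<Rightarrow> ('g \<Rightarrow> real) \<Rightarrow> bool" where
  "escape_function G T f \<longleftrightarrow>
     length_function G f \<and> (\<exists>U. escape_neighbourhood G T f U)"

end

theory Submission
  imports Defs
begin

text \<open>Let \<open>\<rho>\<close> be the rank function. As \<open>x\<^sup>k - 1\<close> is a left multiple of \<open>x - 1\<close>, all powers of a unit close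
  to \<open>1\<close> are equally close to \<open>1\<close>; so an escape function vanishes on a \<open>\<rho>\<close>-ball around \<open>1\<close>, and
  it is enough that every such ball generates \<open>GL(R)\<close>. For a unit \<open>x\<close> outside the ball one takes
  an idempotent \<open>d\<close> of fixed small rank below the right support of \<open>x - 1\<close>, and
  a unit \<open>h\<close> that agrees with \<open>x\<close> on \<open>ker (x - 1) + dR\<close> and has \<open>\<rho>(h - 1) \<le> 2 \<rho>(d)\<close>; then
  \<open>\<rho>(h\<inverse>x - 1) \<le> \<rho>(x - 1) - \<rho>(d)\<close>, and one iterates. Both \<open>d\<close> and \<open>h\<close> come from the fact that any two
  idempotents are comparable. For orthogonal \<open>e\<close>, \<open>f\<close> this is seen on partial
  isomorphisms between \<open>eR\<close> and \<open>fR\<close>, encoded by their graphs: principal right ideals in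
  \<open>(e + f)R\<close> that meet \<open>eR\<close> and \<open>fR\<close> trivially. Upper continuity makes Zorn's lemma
  applicable, and primeness of \<open>R\<close> shows that a maximal graph is total on one side.
  That \<open>R\<close> has a unique rank function is not needed: otherwise \<open>rk\<close> is \<open>0\<close> and
  the topology is indiscrete.\<close>

subsection \<open>Central idempotents of irreducible rings\<close>

text \<open>Products are kept nested to the right, so a known product \<open>x \<otimes> y\<close>
  is hidden as soon as a further factor follows. This form lets the simplifier rewrite such a
  prefix.\<close>

lemma (in monoid) mult_left_cong:
  "\<lbrakk>x \<otimes> y = z; x \<in> carrier G; y \<in> carrier G; w \<in> carrier G\<rbrakk> \<Longrightarrow> x \<otimes> (y \<otimes> w) = z \<otimes> w"
  by (metis m_assoc)

abbreviation (in ring) rideal :: "'a \<Rightarrow> 'a set" where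
  "rideal a \<equiv> a <#\<^bsub>R\<^esub> carrier R"

lemma (in ring) mem_principal_right_ideal:
  "x \<in> rideal a \<longleftrightarrow> (\<exists>r\<in>carrier R. x = a \<otimes> r)"
  by (auto simp: l_coset_def)

lemma (in ring) mem_idempotent_right_ideal:
  assumes "e \<in> carrier R" "e \<otimes> e = e"
  shows "x \<in> rideal e \<longleftrightarrow> x \<in> carrier R \<and> e \<otimes> x = x"
  using assms by (auto simp: mem_principal_right_ideal mult_left_cong[OF assms(2)]) metis

lemma (in ring) diff_mult_distrib:
  assumes "a \<in> carrier R" "b \<in> carrier R" "c \<in> carrier R"
  shows "(a \<ominus> b) \<otimes> c = a \<otimes> c \<ominus> b \<otimes> c" "c \<otimes> (a \<ominus> b) = c \<otimes> a \<ominus> c \<otimes> b"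
  using assms by (simp_all add: a_minus_def l_distr r_distr l_minus r_minus)

lemma (in ring) diff_eq_zero_iff [simp]:
  assumes "a \<in> carrier R" "b \<in> carrier R"
  shows "a \<ominus> b = \<zero> \<longleftrightarrow> a = b"
  using assms by (metis a_minus_def add.inv_closed minus_equality minus_minus r_neg)

lemma (in ring) diff_self [simp]: "a \<in> carrier R \<Longrightarrow> a \<ominus> a = \<zero>"
  by simp

lemma (in ring) add_diff_cancel:
  "\<lbrakk>a \<in> carrier R; b \<in> carrier R\<rbrakk> \<Longrightarrow> a \<oplus> (b \<ominus> a) = b"
  by algebra

lemma (in ring) diff_zero [simp]: "a \<in> carrier R \<Longrightarrow> a \<ominus> \<zero> = a"
  by (simp add: a_minus_def)

text \<open>These rings are the factors of a direct decomposition. Centrality of \<open>e\<close>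
  enters through the right unit law.\<close>

lemma (in ring) corner_ring:
  assumes "e \<in> carrier R" "e \<otimes> e = e" "\<And>x. x \<in> carrier R \<Longrightarrow> x \<otimes> e = e \<otimes> x"
  shows "ring \<lparr>carrier = rideal e, monoid.mult = mult R, one = e, ring.zero = \<zero>, ring.add = add R\<rparr>"
    (is "ring ?S")
proof -
  note mem = mem_idempotent_right_ideal[OF assms(1,2)]
  show ?thesis
  proof (rule ringI)
    show "abelian_group ?S"
    proof (rule abelian_groupI)
      show "\<exists>y\<in>carrier ?S. y \<oplus>\<^bsub>?S\<^esub> x = \<zero>\<^bsub>?S\<^esub>" if "x \<in> carrier ?S" for x
        using that assms(1) by (intro bexI[of _ "\<ominus> x"]) (auto simp: mem r_minus l_neg)
    qed (use assms(1) in \<open>auto simp: mem r_distr a_ac\<close>)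
    show "monoid ?S"
    proof (rule monoidI)
      show "x \<otimes>\<^bsub>?S\<^esub> \<one>\<^bsub>?S\<^esub> = x" if "x \<in> carrier ?S" for x
        using that assms(3)[of x] by (simp add: mem)
    qed (use assms(1,2) in \<open>auto simp: mem simp flip: m_assoc\<close>)
  qed (auto simp: mem l_distr r_distr)
qed

text \<open>Otherwise the Peirce decomposition
  \<open>x = e \<otimes> x \<oplus> f \<otimes> x\<close> with \<open>f = \<one> \<ominus> e\<close>
  would make \<open>R\<close> a product of two non-zero rings.\<close>

lemma (in ring) irreducible_central_idempotent:
  assumes irr: "irreducible_ring R"
    and e: "e \<in> carrier R" "e \<otimes> e = e" "\<And>x. x \<in> carrier R \<Longrightarrow> x \<otimes> e = e \<otimes> x"
  shows "e = \<zero> \<or> e = \<one>"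
proof (rule ccontr)
  assume nt: "\<not> (e = \<zero> \<or> e = \<one>)"
  define f where "f = \<one> \<ominus> e"
  have f: "f \<in> carrier R" "f \<otimes> f = f" "f \<otimes> e = \<zero>" "e \<otimes> f = \<zero>"
    using e(1,2) by (simp_all add: f_def diff_mult_distrib)
  have f': "f \<noteq> \<zero>" "e \<oplus> f = \<one>"
    using e(1) nt by (auto simp: f_def add_diff_cancel)
  have fc: "x \<otimes> f = f \<otimes> x" if "x \<in> carrier R" for x
    using that e(1) e(3)[OF that] by (simp add: f_def diff_mult_distrib)
  define S :: "'a ring" where "S = \<lparr>carrier = rideal e, monoid.mult = mult R, one = e, ring.zero = \<zero>, ring.add = add R\<rparr>"
  define T :: "'a ring" where "T = \<lparr>carrier = rideal f, monoid.mult = mult R, one = f, ring.zero = \<zero>, ring.add = add R\<rparr>"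
  note memS = mem_idempotent_right_ideal[OF e(1,2)]
  note memT = mem_idempotent_right_ideal[OF f(1,2)]
  have "ring S"
    unfolding S_def by (rule corner_ring[OF e])
  moreover have "ring T"
    unfolding T_def by (rule corner_ring[OF f(1,2) fc])
  moreover have "e \<in> carrier S" "f \<in> carrier T"
    using e(1,2) f by (auto simp: S_def T_def memS memT)
  then have "carrier S \<noteq> {\<zero>\<^bsub>S\<^esub>}" "carrier T \<noteq> {\<zero>\<^bsub>T\<^esub>}"
    using nt f' by (auto simp: S_def T_def)
  moreover have "(\<lambda>x. (e \<otimes> x, f \<otimes> x)) \<in> ring_iso R (RDirProd S T)"
  proof (rule ring_iso_memI)
    have comm: "e \<otimes> (x \<otimes> y) = x \<otimes> (e \<otimes> y)" "f \<otimes> (x \<otimes> y) = x \<otimes> (f \<otimes> y)"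
      if "x \<in> carrier R" "y \<in> carrier R" for x y
      using that e(1,3) f(1) fc by (simp_all flip: m_assoc)
    have ef: "e \<otimes> (x \<otimes> (e \<otimes> y)) = e \<otimes> (x \<otimes> y)" "f \<otimes> (x \<otimes> (f \<otimes> y)) = f \<otimes> (x \<otimes> y)"
      if "x \<in> carrier R" "y \<in> carrier R" for x y
      using that e(1,2) f comm[of x y] comm(1)[of x "e \<otimes> y"] comm(2)[of x "f \<otimes> y"]
      by (simp_all add: mult_left_cong[OF e(2)] mult_left_cong[OF f(2)])
    show "bij_betw (\<lambda>x. (e \<otimes> x, f \<otimes> x)) (carrier R) (carrier (RDirProd S T))"
    proof (rule bij_betw_byWitness[where f' = "\<lambda>(x, y). x \<oplus> y"])
      show "\<forall>x\<in>carrier R. (case (e \<otimes> x, f \<otimes> x) of (x, y) \<Rightarrow> x \<oplus> y) = x"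
        using e(1) f(1) f'(2) by (simp flip: l_distr)
      have *: "e \<otimes> y = \<zero>" if "y \<in> carrier R" "f \<otimes> y = y" for y
        using that e(1,2) f by (metis m_assoc l_null)
      have **: "f \<otimes> y = \<zero>" if "y \<in> carrier R" "e \<otimes> y = y" for y
        using that e(1,2) f by (metis m_assoc l_null)
      have "e \<otimes> (x \<oplus> y) = x \<and> f \<otimes> (x \<oplus> y) = y"
        if "x \<in> carrier R" "y \<in> carrier R" "e \<otimes> x = x" "f \<otimes> y = y" for x y
        using that e(1) f(1) *[of y] **[of x] by (simp add: r_distr)
      then show "\<forall>x\<in>carrier (RDirProd S T). (e \<otimes> (case x of (x, y) \<Rightarrow> x \<oplus> y), f \<otimes> (case x of (x, y) \<Rightarrow> x \<oplus> y)) = x"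
        by (auto simp: RDirProd_carrier S_def T_def memS memT)
      show "(\<lambda>x. (e \<otimes> x, f \<otimes> x)) ` carrier R \<subseteq> carrier (RDirProd S T)"
        using e(1,2) f by (auto simp: RDirProd_carrier S_def T_def memS memT mult_left_cong[OF e(2)] mult_left_cong[OF f(2)])
      show "(\<lambda>(x, y). x \<oplus> y) ` carrier (RDirProd S T) \<subseteq> carrier R"
        by (auto simp: RDirProd_carrier S_def T_def memS memT)
    qed
    show "(e \<otimes> x, f \<otimes> x) \<in> carrier (RDirProd S T)" if "x \<in> carrier R" for x
      using e(1,2) f that by (auto simp: RDirProd_carrier S_def T_def memS memT mult_left_cong[OF e(2)] mult_left_cong[OF f(2)])
    fix x y assume xy: "x \<in> carrier R" "y \<in> carrier R"
    show "(e \<otimes> (x \<otimes> y), f \<otimes> (x \<otimes> y)) = (e \<otimes> x, f \<otimes> x) \<otimes>\<^bsub>RDirProd S T\<^esub> (e \<otimes> y, f \<otimes> y)"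
      using e(1) f(1) xy ef by (auto simp: RDirProd_def DirProd_def monoid.defs S_def T_def m_assoc)
    show "(e \<otimes> (x \<oplus> y), f \<otimes> (x \<oplus> y)) = (e \<otimes> x, f \<otimes> x) \<oplus>\<^bsub>RDirProd S T\<^esub> (e \<otimes> y, f \<otimes> y)"
      using e(1) f(1) xy by (auto simp: RDirProd_def DirProd_def monoid.defs S_def T_def r_distr)
  next
    show "(e \<otimes> \<one>, f \<otimes> \<one>) = \<one>\<^bsub>RDirProd S T\<^esub>"
      using e(1) f(1) by (auto simp: RDirProd_def DirProd_def monoid.defs S_def T_def)
  qed
  then have "R \<simeq> RDirProd S T"
    unfolding is_ring_iso_def by blast
  ultimately show False
    using irr unfolding irreducible_ring_def by blast
qed

subsection \<open>Principal right ideals and primeness\<close>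

locale unital_regular_ring = ring +
  assumes quasi_inverse: "a \<in> carrier R \<Longrightarrow> \<exists>b\<in>carrier R. a \<otimes> b \<otimes> a = a"
begin

lemma quasi_inverseE:
  assumes "a \<in> carrier R"
  obtains b where "b \<in> carrier R" "a \<otimes> (b \<otimes> a) = a"
  using quasi_inverse[OF assms] assms by (metis m_assoc)

text \<open>If \<open>a \<otimes> b \<otimes> a = a\<close>, then
  \<open>\<one> \<ominus> b \<otimes> a\<close> is annihilated by \<open>a\<close> and acts as the
  identity on everything that \<open>a\<close> annihilates.\<close>

lemma right_annihilator_principal:
  assumes "a \<in> carrier R"
  shows "{x \<in> carrier R. a \<otimes> x = \<zero>} \<in> principal_right_ideals R"
proof -
  obtain b where b: "b \<in> carrier R" "a \<otimes> (b \<otimes> a) = a"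
    using quasi_inverseE assms by blast
  let ?e = "\<one> \<ominus> b \<otimes> a"
  have ae: "a \<otimes> ?e = \<zero>"
    using assms b by (simp add: diff_mult_distrib)
  have "{x \<in> carrier R. a \<otimes> x = \<zero>} = rideal ?e"
  proof (intro equalityI subsetI)
    fix x assume "x \<in> {x \<in> carrier R. a \<otimes> x = \<zero>}"
    then have "x \<in> carrier R" "?e \<otimes> x = x"
      using assms b by (simp_all add: diff_mult_distrib m_assoc)
    then show "x \<in> rideal ?e"
      unfolding mem_principal_right_ideal by metis
  next
    fix x assume "x \<in> rideal ?e"
    then show "x \<in> {x \<in> carrier R. a \<otimes> x = \<zero>}"
      using assms b by (auto simp: mem_principal_right_ideal mult_left_cong[OF ae])
  qed
  then show ?thesis
    using assms b unfolding principal_right_ideals_def by (metis (mono_tags, lifting) m_closed mem_Collect_eq minus_closed one_closed)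
qed

lemma principal_idempotentE:
  assumes "a \<in> carrier R"
  obtains e where "e \<in> carrier R" "e \<otimes> e = e" "rideal a = rideal e"
proof -
  obtain b where b: "b \<in> carrier R" "a \<otimes> (b \<otimes> a) = a"
    using quasi_inverseE assms by blast
  have "rideal a = rideal (a \<otimes> b)"
  proof (intro equalityI subsetI)
    fix x assume "x \<in> rideal a"
    then obtain r where "r \<in> carrier R" "x = a \<otimes> r"
      by (auto simp: mem_principal_right_ideal)
    moreover from this have "x = a \<otimes> b \<otimes> (a \<otimes> r)"
      using assms b mult_left_cong[OF b(2)] by (simp add: m_assoc)
    ultimately show "x \<in> rideal (a \<otimes> b)"
      unfolding mem_principal_right_ideal using assms by blast
  next
    fix x assume "x \<in> rideal (a \<otimes> b)"
    then show "x \<in> rideal a"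
      using assms b by (auto simp: mem_principal_right_ideal m_assoc)
  qed
  moreover have "a \<otimes> b \<otimes> (a \<otimes> b) = a \<otimes> b"
    using assms b by (metis m_assoc m_closed)
  ultimately show thesis
    using that[of "a \<otimes> b"] assms b by simp
qed

text \<open>The third hypothesis says that \<open>rideal f\<close> is a two-sided ideal. The
  obstruction \<open>z = f r (1 - f)\<close> vanishes by regularity: a factor
  \<open>(1 - f) w f = 0\<close> occurs inside \<open>z w z = z\<close>.\<close>

lemma two_sided_ideal_idempotent_central:
  assumes f: "f \<in> carrier R" "f \<otimes> f = f"
    and "\<And>r. r \<in> carrier R \<Longrightarrow> f \<otimes> (r \<otimes> f) = r \<otimes> f"
    and r: "r \<in> carrier R"
  shows "r \<otimes> f = f \<otimes> r"
proof -
  let ?z = "f \<otimes> (r \<otimes> (\<one> \<ominus> f))"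
  obtain w where w: "w \<in> carrier R" "?z \<otimes> (w \<otimes> ?z) = ?z"
    using quasi_inverseE[of ?z] f r by blast
  have wf: "(\<one> \<ominus> f) \<otimes> (w \<otimes> f) = \<zero>"
    using f w(1) assms(3)[of w] by (simp add: diff_mult_distrib)
  have "?z \<otimes> (w \<otimes> ?z) = f \<otimes> (r \<otimes> ((\<one> \<ominus> f) \<otimes> (w \<otimes> f) \<otimes> (r \<otimes> (\<one> \<ominus> f))))"
    using f r w(1) by (simp add: m_assoc)
  then have "?z = \<zero>"
    using wf w f r by simp
  then show ?thesis
    using f r assms(3)[OF r] by (simp add: diff_mult_distrib)
qed

end

lemma (in ring) mem_rideal_self: "a \<in> carrier R \<Longrightarrow> a \<in> rideal a"
  unfolding mem_principal_right_ideal by (metis one_closed r_one)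

lemma (in ring) rideal_subset: "a \<in> carrier R \<Longrightarrow> rideal a \<subseteq> carrier R"
  by (auto simp: mem_principal_right_ideal)

lemma (in ring) rideal_closed:
  "\<lbrakk>a \<in> carrier R; x \<in> rideal a; r \<in> carrier R\<rbrakk> \<Longrightarrow> x \<otimes> r \<in> rideal a"
  by (auto simp: mem_principal_right_ideal m_assoc)

lemma (in ring) rideal_subset_iff:
  assumes "a \<in> carrier R" "b \<in> carrier R"
  shows "rideal a \<subseteq> rideal b \<longleftrightarrow> a \<in> rideal b"
proof
  show "a \<in> rideal b" if "rideal a \<subseteq> rideal b"
    using that mem_rideal_self assms(1) by blast
  show "rideal a \<subseteq> rideal b" if "a \<in> rideal b"
    using that rideal_closed assms by (metis mem_principal_right_ideal subsetI)
qed

section \<open>Infima, suprema of chains, and primeness in continuous rings\<close>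

locale unital_continuous_ring =
  fixes R (structure)
  assumes continuous: "continuous_ring R"

sublocale unital_continuous_ring \<subseteq> unital_regular_ring
proof -
  have "regular_ring R"
    using continuous by (simp add: continuous_ring_def)
  then show "unital_regular_ring R"
    by (simp add: regular_ring_def unital_regular_ring_def unital_regular_ring_axioms_def)
qed

context unital_continuous_ring
begin

lemma complete: "complete_lattice (right_ideal_lattice R)"
  using continuous by (simp add: continuous_ring_def)

text \<open>Completeness only gives an infimum within the lattice. It equals the intersection, since
  any common element generates a principal right ideal that is a lower bound.\<close>

lemma Inter_principal:
  assumes "\<A> \<subseteq> principal_right_ideals R" "\<A> \<noteq> {}"
  shows "\<Inter>\<A> \<in> principal_right_ideals R"
proof -
  obtain I where I: "greatest (right_ideal_lattice R) I (Lower (right_ideal_lattice R) \<A>)"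
    using complete_lattice.inf_exists[OF complete, of \<A>] assms(1)
    by (auto simp: right_ideal_lattice_def)
  have lower: "J \<in> Lower (right_ideal_lattice R) \<A> \<longleftrightarrow> J \<in> principal_right_ideals R \<and> (\<forall>A\<in>\<A>. J \<subseteq> A)" for J
    using assms(1) by (auto simp: Lower_def right_ideal_lattice_def)
  have "I \<in> principal_right_ideals R" and I1: "\<And>A. A \<in> \<A> \<Longrightarrow> I \<subseteq> A"
    and I2: "\<And>J. J \<in> principal_right_ideals R \<Longrightarrow> \<forall>A\<in>\<A>. J \<subseteq> A \<Longrightarrow> J \<subseteq> I"
    using I lower by (auto simp: greatest_def right_ideal_lattice_def)
  moreover have "\<Inter>\<A> \<subseteq> I"
  proof
    fix x assume x: "x \<in> \<Inter>\<A>"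
    then have xc: "x \<in> carrier R"
      using assms rideal_subset unfolding principal_right_ideals_def by blast
    have "rideal x \<subseteq> A" if "A \<in> \<A>" for A
    proof -
      obtain a where "a \<in> carrier R" "A = rideal a"
        using subsetD[OF assms(1) \<open>A \<in> \<A>\<close>] unfolding principal_right_ideals_def by blast
      then show ?thesis
        using x that xc by (auto simp: rideal_subset_iff)
    qed
    then have "rideal x \<subseteq> I"
      using I2 xc by (auto simp: principal_right_ideals_def)
    then show "x \<in> I"
      using mem_rideal_self[OF xc] by blast
  qed
  ultimately show ?thesis
    by (metis Inter_greatest subset_antisym)
qed

text \<open>This prepares Zorn's lemma. The lattice supremum can exceed the union of the chain, so
  it is upper continuity that keeps it disjoint from \<open>rideal e\<close>.\<close>

lemma chain_upper_bound:
  assumes chain: "subset.chain (principal_right_ideals R) \<C>" "\<C> \<noteq> {}"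
    and a: "a \<in> carrier R" "\<And>K. K \<in> \<C> \<Longrightarrow> K \<subseteq> rideal a"
  obtains U where "U \<in> principal_right_ideals R" "\<And>K. K \<in> \<C> \<Longrightarrow> K \<subseteq> U" "U \<subseteq> rideal a"
    "\<And>e. \<lbrakk>e \<in> carrier R; \<And>K. K \<in> \<C> \<Longrightarrow> K \<inter> rideal e = {\<zero>}\<rbrakk> \<Longrightarrow> U \<inter> rideal e = {\<zero>}"
proof -
  let ?L = "right_ideal_lattice R"
  let ?P = "principal_right_ideals R"
  interpret L: complete_lattice ?L by (rule complete)
  have [simp]: "carrier ?L = ?P" and le [simp]: "\<And>A B. A \<sqsubseteq>\<^bsub>?L\<^esub> B \<longleftrightarrow> A \<subseteq> B"
    by (simp_all add: right_ideal_lattice_def)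
  have CP: "\<C> \<subseteq> ?P"
    using chain by (simp add: subset.chain_def)
  have rP: "rideal x \<in> ?P" if "x \<in> carrier R" for x
    using that by (auto simp: principal_right_ideals_def)
  define U where "U = \<Squnion>\<^bsub>?L\<^esub> \<C>"
  have UP: "U \<in> ?P"
    using L.sup_closed[of \<C>] CP by (simp add: U_def)
  have zero: "\<zero> \<in> A" if "A \<in> ?P" for A
  proof -
    obtain a where "a \<in> carrier R" "A = rideal a"
      using \<open>A \<in> ?P\<close> unfolding principal_right_ideals_def by blast
    then show ?thesis
      by (metis mem_principal_right_ideal r_null zero_closed)
  qed
  have zP: "{\<zero>} \<in> ?P"
  proof -
    have "rideal \<zero> = {\<zero>}"
      using mem_rideal_self[of \<zero>] by (auto simp: mem_principal_right_ideal)
    then show ?thesis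
      using rP[of \<zero>] by simp
  qed
  have "U \<inter> rideal e = {\<zero>}" if e: "e \<in> carrier R" "\<And>K. K \<in> \<C> \<Longrightarrow> K \<inter> rideal e = {\<zero>}" for e
  proof -
    have meet: "rideal e \<sqinter>\<^bsub>?L\<^esub> J = {\<zero>}" if "J \<in> \<C>" for J
    proof -
      have "J \<in> ?P" using that CP by blast
      then have "rideal e \<sqinter>\<^bsub>?L\<^esub> J \<subseteq> rideal e" "rideal e \<sqinter>\<^bsub>?L\<^esub> J \<subseteq> J" "rideal e \<sqinter>\<^bsub>?L\<^esub> J \<in> ?P"
        using L.meet_left[of "rideal e" J] L.meet_right[of "rideal e" J] L.meet_closed[of "rideal e" J] rP[OF e(1)]
        by auto
      then show ?thesis
        using e(2)[OF that] zero by blast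
    qed
    have "rideal e \<sqinter>\<^bsub>?L\<^esub> U = \<Squnion>\<^bsub>?L\<^esub> {rideal e \<sqinter>\<^bsub>?L\<^esub> J | J. J \<in> \<C>}"
      using continuous chain(1) rP[OF e(1)] unfolding continuous_ring_def U_def by blast
    also have "{rideal e \<sqinter>\<^bsub>?L\<^esub> J | J. J \<in> \<C>} = {{\<zero>}}"
      using meet chain(2) by auto
    also have "\<Squnion>\<^bsub>?L\<^esub> {{\<zero>}} = {\<zero>}"
      using L.sup_of_singleton zP by simp
    finally have m: "rideal e \<sqinter>\<^bsub>?L\<^esub> U = {\<zero>}" .
    have "x = \<zero>" if "x \<in> U" "x \<in> rideal e" for x
    proof -
      obtain u where u: "u \<in> carrier R" "U = rideal u"
        using UP by (auto simp: principal_right_ideals_def)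
      have x: "x \<in> carrier R"
        using that(2) rideal_subset e(1) by blast
      have "rideal x \<subseteq> rideal e \<sqinter>\<^bsub>?L\<^esub> U"
        using L.meet_le[of "rideal x" "rideal e" U] rP x e(1) u that by (simp add: rideal_subset_iff)
      then show ?thesis
        using m mem_rideal_self[OF x] by auto
    qed
    then show ?thesis
      using zero[OF UP] zero[OF rP[OF e(1)]] by blast
  qed
  moreover have "K \<subseteq> U" if "K \<in> \<C>" for K
    using L.sup_upper[of \<C> K] CP that by (simp add: U_def)
  moreover have "U \<subseteq> rideal a"
    using L.sup_least[of \<C> "rideal a"] CP a rP by (simp add: U_def)
  ultimately show thesis
    using that UP by blast
qed

text \<open>This turns irreducibility, a statement about products, into one about elements. If
  \<open>a R b\<close> were zero, the central idempotent obtained below would be non-zero because of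
  \<open>b\<close> and different from one because of \<open>a\<close>.\<close>

lemma prime:
  assumes irr: "irreducible_ring R"
    and a: "a \<in> carrier R" "a \<noteq> \<zero>" and b: "b \<in> carrier R" "b \<noteq> \<zero>"
  obtains r where "r \<in> carrier R" "a \<otimes> (r \<otimes> b) \<noteq> \<zero>"
proof (rule ccontr)
  assume no: "\<not> thesis"
  \<comment> \<open>\<open>J\<close> is a two-sided ideal, and an intersection of annihilators, hence principal and generated by a central idempotent.\<close>
  define J where "J = {x \<in> carrier R. \<forall>r\<in>carrier R. a \<otimes> (r \<otimes> x) = \<zero>}"
  have "J = (\<Inter>r\<in>carrier R. {x \<in> carrier R. a \<otimes> r \<otimes> x = \<zero>})"
    using a unfolding J_def by (auto simp: m_assoc) (metis m_assoc)
  moreover have "\<dots> \<in> principal_right_ideals R"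
    using a by (intro Inter_principal) (auto intro: right_annihilator_principal)
  ultimately obtain c where "c \<in> carrier R" "J = rideal c"
    unfolding principal_right_ideals_def by auto
  then obtain f where f: "f \<in> carrier R" "f \<otimes> f = f" "J = rideal f"
    using principal_idempotentE by metis
  have fJ: "x \<in> J \<longleftrightarrow> x \<in> carrier R \<and> f \<otimes> x = x" for x
    using f mem_idempotent_right_ideal by simp
  have "r \<otimes> x \<in> J" if "x \<in> J" "r \<in> carrier R" for x r
  proof -
    have "a \<otimes> (s \<otimes> (r \<otimes> x)) = a \<otimes> (s \<otimes> r \<otimes> x)" if "s \<in> carrier R" for s
      using \<open>x \<in> J\<close> \<open>r \<in> carrier R\<close> that a by (simp add: J_def m_assoc)
    then show ?thesis
      using that by (auto simp: J_def)
  qed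
  then have "f \<otimes> (r \<otimes> f) = r \<otimes> f" if "r \<in> carrier R" for r
    using that fJ f by blast
  then have "r \<otimes> f = f \<otimes> r" if "r \<in> carrier R" for r
    using two_sided_ideal_idempotent_central f that by blast
  then have "f = \<zero> \<or> f = \<one>"
    using irreducible_central_idempotent irr f by blast
  moreover have "b \<in> J"
    using no that b unfolding J_def by blast
  then have "f \<noteq> \<zero>"
    using b fJ[of b] by auto
  moreover have "\<one> \<notin> J"
  proof
    assume "\<one> \<in> J"
    then have "a \<otimes> (\<one> \<otimes> \<one>) = \<zero>"
      unfolding J_def by blast
    then show False
      using a by simp
  qed
  then have "f \<noteq> \<one>"
    using fJ[of \<one>] by auto
  ultimately show False
    by blast
qed

end

section \<open>Orthogonal sums and complements in regular rings\<close>

context unital_regular_ring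
begin

text \<open>One step of orthogonalisation: \<open>e\<close> projects onto \<open>aR\<close>, and
  \<open>g\<close> onto the part of \<open>bR\<close> left after removing \<open>e\<close>. Of the
  two formulas for \<open>g\<close>, the first bounds its rank by that of \<open>b\<close>, and the
  second places it in \<open>aR + bR\<close>.\<close>

lemma orthogonal_cover:
  assumes a: "a \<in> carrier R" and b: "b \<in> carrier R"
  obtains e g p r s where
    "e \<in> carrier R" "g \<in> carrier R" "e \<otimes> e = e" "g \<otimes> g = g" "e \<otimes> g = \<zero>" "g \<otimes> e = \<zero>"
    "(e \<oplus> g) \<otimes> a = a" "(e \<oplus> g) \<otimes> b = b"
    "p \<in> carrier R" "e = a \<otimes> p" "r \<in> carrier R" "s \<in> carrier R" "g = r \<otimes> (b \<otimes> s)"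
    "g = b \<otimes> s \<ominus> a \<otimes> (p \<otimes> (b \<otimes> s))"
proof -
  obtain p where p: "p \<in> carrier R" "a \<otimes> (p \<otimes> a) = a"
    using quasi_inverseE a by blast
  define e where "e = a \<otimes> p"
  define c where "c = b \<ominus> e \<otimes> b"
  have e: "e \<in> carrier R" "e \<otimes> e = e" "e \<otimes> a = a"
    using a p mult_left_cong[OF p(2)] by (simp_all add: e_def m_assoc)
  have c: "c \<in> carrier R" "e \<otimes> c = \<zero>"
    using e b mult_left_cong[OF e(2)] by (simp_all add: c_def diff_mult_distrib)
  obtain q where q: "q \<in> carrier R" "c \<otimes> (q \<otimes> c) = c"
    using quasi_inverseE c by blast
  \<comment> \<open>The factor \<open>\<one> \<ominus> e\<close> forces
    \<open>g \<otimes> e = \<zero>\<close>. It does not affect \<open>g \<otimes> c = c\<close>,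
    since \<open>e\<close> kills \<open>c\<close>.\<close>
  define s where "s = q \<otimes> (\<one> \<ominus> e)"
  define g where "g = c \<otimes> s"
  have s: "s \<in> carrier R" "s \<otimes> e = \<zero>" "s \<otimes> c = q \<otimes> c"
    using e c q by (simp_all add: s_def diff_mult_distrib m_assoc)
  have g: "g \<in> carrier R" "e \<otimes> g = \<zero>" "g \<otimes> e = \<zero>" "g \<otimes> c = c"
    using e(1) c s q mult_left_cong[OF c(2)] by (simp_all add: g_def m_assoc)
  have "g \<otimes> g = g"
    using g(4) g(1) c s(1) by (metis g_def m_assoc)
  moreover have ga: "g \<otimes> a = \<zero>"
    using g(1,3) e a by (metis l_null m_assoc)
  then have "(e \<oplus> g) \<otimes> a = a"
    using e g a by (simp add: l_distr)
  moreover have "g \<otimes> b = c"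
  proof -
    have "g \<otimes> b = g \<otimes> (c \<oplus> e \<otimes> b)"
      using e(1) b by (simp add: c_def a_minus_def a_assoc l_neg)
    also have "\<dots> = c"
      using e(1) b c(1) g by (simp add: r_distr mult_left_cong[OF g(3)])
    finally show ?thesis .
  qed
  then have "(e \<oplus> g) \<otimes> b = b"
    using e g b by (simp add: l_distr c_def add_diff_cancel)
  moreover have "g = (\<one> \<ominus> e) \<otimes> (b \<otimes> s)"
    using e b s by (simp add: g_def c_def diff_mult_distrib m_assoc)
  moreover have "g = b \<otimes> s \<ominus> a \<otimes> (p \<otimes> (b \<otimes> s))"
    using a b s p by (simp add: g_def c_def e_def diff_mult_distrib m_assoc)
  ultimately show thesis
    using that[of e g p "\<one> \<ominus> e" s] e g s(1) p(1) e_def by auto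
qed

text \<open>As \<open>qR\<close> and \<open>nR\<close> meet trivially, \<open>(1 - q) n\<close> is
  injective on \<open>nR\<close>. Composing it with a quasi-inverse gives a projection onto
  \<open>nR\<close> that kills \<open>q\<close>.\<close>

lemma idempotent_complement:
  assumes q: "q \<in> carrier R" "q \<otimes> q = q" and n: "n \<in> carrier R" "n \<otimes> n = n"
    and disjoint: "\<And>z. \<lbrakk>z \<in> carrier R; q \<otimes> z = z; n \<otimes> z = z\<rbrakk> \<Longrightarrow> z = \<zero>"
  obtains m where "m \<in> carrier R" "m \<otimes> m = m" "m \<otimes> n = n" "n \<otimes> m = m" "m \<otimes> q = \<zero>"
proof -
  define w where "w = n \<ominus> q \<otimes> n"
  have w: "w \<in> carrier R"
    using q n by (simp add: w_def)
  obtain v where v: "v \<in> carrier R" "w \<otimes> (v \<otimes> w) = w"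
    using quasi_inverseE w by blast
  define m where "m = n \<otimes> (v \<otimes> (\<one> \<ominus> q))"
  have m: "m \<in> carrier R" "n \<otimes> m = m" "m \<otimes> q = \<zero>"
    using q n v mult_left_cong[OF n(2)] by (simp_all add: m_def m_assoc diff_mult_distrib)
  have mn: "m \<otimes> n = n \<otimes> (v \<otimes> w)"
    using q n v by (simp add: m_def w_def m_assoc diff_mult_distrib)
  have wn: "w \<otimes> n = w"
    using q n by (simp add: w_def m_assoc diff_mult_distrib)
  \<comment> \<open>\<open>z\<close> is the defect in \<open>m \<otimes> n = n\<close>. From
    \<open>w \<otimes> z = \<zero>\<close> it lies in \<open>qR\<close> as well as in
    \<open>nR\<close>, hence is zero.\<close>
  define z where "z = n \<ominus> n \<otimes> (v \<otimes> w)"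
  have z: "z \<in> carrier R" "n \<otimes> z = z"
    using n v w by (simp_all add: z_def diff_mult_distrib mult_left_cong[OF n(2)])
  have "w \<otimes> z = \<zero>"
    using n v w by (simp add: z_def diff_mult_distrib mult_left_cong[OF wn] wn)
  moreover have "w \<otimes> z = z \<ominus> q \<otimes> z"
    using q n z by (simp add: w_def diff_mult_distrib m_assoc)
  ultimately have "z = \<zero>"
    using disjoint z q by simp
  then have "m \<otimes> n = n"
    using mn n v w by (simp add: z_def)
  then have "m \<otimes> m = m"
    using m n by (metis m_assoc)
  then show thesis
    using that m \<open>m \<otimes> n = n\<close> by blast
qed

end

subsection \<open>Comparability of idempotents\<close>

text \<open>For idempotents this is the usual comparison: \<open>eR\<close> is isomorphic to a
  principal right ideal inside \<open>fR\<close>. Leaving \<open>t\<close> and \<open>s\<close>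
  unnormalised makes transitivity and monotonicity of the rank immediate.\<close>

definition (in ring) subequivalent :: "'a \<Rightarrow> 'a \<Rightarrow> bool" where
  "subequivalent e f \<longleftrightarrow> (\<exists>t\<in>carrier R. \<exists>s\<in>carrier R. e = t \<otimes> (f \<otimes> s))"

lemma (in ring) subequivalentI:
  "\<lbrakk>e = t \<otimes> (f \<otimes> s); t \<in> carrier R; s \<in> carrier R\<rbrakk> \<Longrightarrow> subequivalent e f"
  by (auto simp: subequivalent_def)

lemma (in ring) subequivalent_trans:
  assumes "subequivalent e f" "subequivalent f g" "g \<in> carrier R"
  shows "subequivalent e g"
proof -
  obtain t s where ts: "t \<in> carrier R" "s \<in> carrier R" "e = t \<otimes> (f \<otimes> s)"
    using assms(1) by (auto simp: subequivalent_def)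
  obtain t' s' where ts': "t' \<in> carrier R" "s' \<in> carrier R" "f = t' \<otimes> (g \<otimes> s')"
    using assms(2) by (auto simp: subequivalent_def)
  have "e = t \<otimes> t' \<otimes> (g \<otimes> (s' \<otimes> s))"
    using ts ts' assms(3) by (simp add: m_assoc)
  then show ?thesis
    using ts ts' by (auto intro: subequivalentI)
qed

lemma (in ring) subequivalent_mult_left:
  "\<lbrakk>f \<otimes> e = e; e \<in> carrier R; f \<in> carrier R\<rbrakk> \<Longrightarrow> subequivalent e f"
  by (rule subequivalentI[of e \<one> f e]) auto

text \<open>The right ideal \<open>kR\<close> is the graph of a map from \<open>eR\<close> to \<open>fR\<close>, everywhere defined by \<open>total\<close> and injective by \<open>inj\<close>.\<close>

lemma (in unital_regular_ring) graph_subequivalent: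
  assumes "k \<in> carrier R" "r \<in> carrier R" "e \<in> carrier R" "f \<in> carrier R"
    and total: "e = e \<otimes> (k \<otimes> r)"
    and inj: "\<And>z. \<lbrakk>z \<in> carrier R; f \<otimes> (k \<otimes> z) = \<zero>\<rbrakk> \<Longrightarrow> k \<otimes> z = \<zero>"
  shows "subequivalent e f"
proof -
  obtain w where w: "w \<in> carrier R" "(f \<otimes> k) \<otimes> (w \<otimes> (f \<otimes> k)) = f \<otimes> k"
    using quasi_inverseE[of "f \<otimes> k"] assms(1,4) by blast
  \<comment> \<open>Injectivity at this element yields \<open>k = k w f k\<close>, so
    \<open>k\<close>, and with it \<open>e = e k r\<close>, factors through
    \<open>f\<close>.\<close>
  have "f \<otimes> (k \<otimes> (w \<otimes> (f \<otimes> k) \<ominus> \<one>)) = \<zero>"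
    using assms(1,4) w by (simp add: m_assoc diff_mult_distrib)
  then have "k \<otimes> (w \<otimes> (f \<otimes> k) \<ominus> \<one>) = \<zero>"
    using inj assms(1,4) w(1) by simp
  then have kk: "k \<otimes> (w \<otimes> (f \<otimes> k)) = k"
    using assms(1,4) w(1) by (simp add: diff_mult_distrib)
  then have "k \<otimes> (w \<otimes> (f \<otimes> (k \<otimes> r))) = k \<otimes> r"
    using assms(1,2,4) w(1) by (metis m_assoc m_closed)
  then have "e = e \<otimes> (k \<otimes> w) \<otimes> (f \<otimes> (k \<otimes> r))"
    using total assms(1-4) w(1) by (simp add: m_assoc)
  then show ?thesis
    by (rule subequivalentI) (use assms w in auto)
qed

context unital_continuous_ring
begin

lemma comparable_orthogonal:
  assumes irr: "irreducible_ring R"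
    and e: "e \<in> carrier R" "e \<otimes> e = e" and f: "f \<in> carrier R" "f \<otimes> f = f"
    and ef: "e \<otimes> f = \<zero>" "f \<otimes> e = \<zero>"
  shows "subequivalent e f \<or> subequivalent f e"
proof (rule ccontr)
  assume no: "\<not> (subequivalent e f \<or> subequivalent f e)"
  note mem_e = mem_idempotent_right_ideal[OF e]
  note mem_f = mem_idempotent_right_ideal[OF f]
  \<comment> \<open>Inside \<open>eR + fR\<close>, trivial intersection with \<open>fR\<close> makes
    the graph single-valued, and trivial intersection with \<open>eR\<close> makes it
    injective.\<close>
  define P where "P = {K \<in> principal_right_ideals R.
    K \<subseteq> rideal (e \<oplus> f) \<and> K \<inter> rideal e = {\<zero>} \<and> K \<inter> rideal f = {\<zero>}}"
  have sum: "e \<oplus> f \<in> carrier R" "(e \<oplus> f) \<otimes> (e \<oplus> f) = e \<oplus> f"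
    using e f ef by (simp_all add: l_distr r_distr)
  note mem_sum = mem_idempotent_right_ideal[OF sum]
  have zero_rideal: "rideal \<zero> = {\<zero>}"
    using mem_rideal_self[of \<zero>] by (auto simp: mem_principal_right_ideal)
  have "{\<zero>} \<in> P"
  proof -
    have "rideal \<zero> \<in> principal_right_ideals R"
      unfolding principal_right_ideals_def by blast
    then show ?thesis
      using e f sum zero_rideal by (simp add: P_def mem_e mem_f mem_sum)
  qed
  have "\<exists>M\<in>P. (\<forall>N\<in>P. M \<subseteq> N \<longrightarrow> N = M)"
  proof (rule subset_Zorn)
    fix \<C> assume C: "subset.chain P \<C>"
    show "\<exists>U\<in>P. \<forall>N\<in>\<C>. N \<subseteq> U"
    proof (cases "\<C> = {}")
      case True
      then show ?thesis using \<open>{\<zero>} \<in> P\<close> by blast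
    next
      case False
      have CP: "\<C> \<subseteq> P"
        using C by (simp add: subset.chain_def)
      have "P \<subseteq> principal_right_ideals R"
        by (auto simp: P_def)
      then have "subset.chain (principal_right_ideals R) \<C>"
        using C unfolding subset.chain_def by blast
      then obtain U where U: "U \<in> principal_right_ideals R" "\<And>K. K \<in> \<C> \<Longrightarrow> K \<subseteq> U"
        "U \<subseteq> rideal (e \<oplus> f)"
        "\<And>e. \<lbrakk>e \<in> carrier R; \<And>K. K \<in> \<C> \<Longrightarrow> K \<inter> rideal e = {\<zero>}\<rbrakk> \<Longrightarrow> U \<inter> rideal e = {\<zero>}"
        by (rule chain_upper_bound[of \<C> "e \<oplus> f"]) (use False sum CP in \<open>auto simp: P_def\<close>)
      have "U \<inter> rideal e = {\<zero>}" "U \<inter> rideal f = {\<zero>}"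
        using CP e f by (auto simp: P_def intro!: U(4))
      then have "U \<in> P"
        using U by (simp add: P_def)
      then show ?thesis using U(2) by blast
    qed
  qed
  then obtain K where K: "K \<in> P" "\<And>N. N \<in> P \<Longrightarrow> K \<subseteq> N \<Longrightarrow> N = K"
    by blast
  then obtain k where k: "k \<in> carrier R" "K = rideal k"
    unfolding P_def principal_right_ideals_def by blast
  have Ke: "\<And>x. x \<in> rideal k \<Longrightarrow> x \<in> rideal e \<Longrightarrow> x = \<zero>"
    and Kf: "\<And>x. x \<in> rideal k \<Longrightarrow> x \<in> rideal f \<Longrightarrow> x = \<zero>"
    using K(1) k by (auto simp: P_def)
  have kz: "k \<otimes> z \<in> rideal k" if "z \<in> carrier R" for z
    using that k(1) mem_principal_right_ideal by blast
  have sum_k: "(e \<oplus> f) \<otimes> k = k"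
    using K(1) k mem_rideal_self[OF k(1)] mem_sum by (auto simp: P_def)
  then have k_sum: "k \<otimes> z = e \<otimes> (k \<otimes> z) \<oplus> f \<otimes> (k \<otimes> z)" if "z \<in> carrier R" for z
    using that e(1) f(1) k(1) by (metis l_distr m_assoc m_closed sum(1))
  have inj_f: "k \<otimes> z = \<zero>" if "z \<in> carrier R" "f \<otimes> (k \<otimes> z) = \<zero>" for z
  proof -
    have "e \<otimes> (k \<otimes> z) = k \<otimes> z"
      using k_sum[OF that(1)] that e(1) k(1) by simp
    then show ?thesis
      using Ke[OF kz] that k(1) by (simp add: mem_e)
  qed
  have inj_e: "k \<otimes> z = \<zero>" if "z \<in> carrier R" "e \<otimes> (k \<otimes> z) = \<zero>" for z
  proof -
    have "f \<otimes> (k \<otimes> z) = k \<otimes> z"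
      using k_sum[OF that(1)] that f(1) k(1) by simp
    then show ?thesis
      using Kf[OF kz] that k(1) by (simp add: mem_f)
  qed
  obtain v where v: "v \<in> carrier R" "(e \<otimes> k) \<otimes> (v \<otimes> (e \<otimes> k)) = e \<otimes> k"
    using quasi_inverseE[of "e \<otimes> k"] e k(1) by blast
  obtain u where u: "u \<in> carrier R" "(f \<otimes> k) \<otimes> (u \<otimes> (f \<otimes> k)) = f \<otimes> k"
    using quasi_inverseE[of "f \<otimes> k"] f k(1) by blast
  \<comment> \<open>\<open>x\<close> and \<open>y\<close> are idempotents onto the domain
    \<open>ekR\<close> and the range \<open>fkR\<close> of the maximal graph. Below,
    \<open>a\<close> and \<open>b\<close> describe what the domain and the range miss; either one
    being zero would make the graph total on that side.\<close>
  define x where "x = e \<otimes> (k \<otimes> v)"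
  define y where "y = f \<otimes> (k \<otimes> u)"
  have x: "x \<in> carrier R" "e \<otimes> x = x" "x \<otimes> (e \<otimes> k) = e \<otimes> k"
    using e k(1) v mult_left_cong[OF e(2)] by (simp_all add: x_def m_assoc)
  have y: "y \<in> carrier R" "f \<otimes> y = y" "y \<otimes> (f \<otimes> k) = f \<otimes> k"
    using f k(1) u mult_left_cong[OF f(2)] by (simp_all add: y_def m_assoc)
  define a where "a = e \<ominus> x \<otimes> e"
  define b where "b = f \<ominus> y \<otimes> f"
  have "a \<noteq> \<zero>"
  proof
    assume "a = \<zero>"
    then have "e = e \<otimes> (k \<otimes> (v \<otimes> e))"
      using e(1) k(1) v(1) x(1) by (simp add: a_def x_def m_assoc)
    then have "subequivalent e f"
      using graph_subequivalent[of k "v \<otimes> e" e f] e f k(1) v(1) inj_f by simp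
    then show False using no by blast
  qed
  have "b \<noteq> \<zero>"
  proof
    assume "b = \<zero>"
    then have "f = f \<otimes> (k \<otimes> (u \<otimes> f))"
      using f(1) k(1) u(1) y(1) by (simp add: b_def y_def m_assoc)
    then have "subequivalent f e"
      using graph_subequivalent[of k "u \<otimes> f" f e] e f k(1) u(1) inj_e by simp
    then show False using no by blast
  qed
  have a: "a \<in> carrier R" "e \<otimes> a = a" "x \<otimes> a = \<zero>"
  proof -
    have "x \<otimes> (x \<otimes> e) = x \<otimes> e"
      using x e v k(1) mult_left_cong[OF x(3)] by (simp add: x_def m_assoc)
    moreover have "e \<otimes> (x \<otimes> e) = x \<otimes> e"
      using x e by (simp add: mult_left_cong[OF x(2)])
    ultimately show "a \<in> carrier R" "e \<otimes> a = a" "x \<otimes> a = \<zero>"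
      using x(1) e by (simp_all add: a_def diff_mult_distrib)
  qed
  have b: "b \<in> carrier R" "f \<otimes> b = b" "y \<otimes> b = \<zero>"
  proof -
    have "y \<otimes> (y \<otimes> f) = y \<otimes> f"
      using y f u k(1) mult_left_cong[OF y(3)] by (simp add: y_def m_assoc)
    moreover have "f \<otimes> (y \<otimes> f) = y \<otimes> f"
      using y f by (simp add: mult_left_cong[OF y(2)])
    ultimately show "b \<in> carrier R" "f \<otimes> b = b" "y \<otimes> b = \<zero>"
      using y(1) f by (simp_all add: b_def diff_mult_distrib)
  qed
  obtain r where r: "r \<in> carrier R" "a \<otimes> (r \<otimes> b) \<noteq> \<zero>"
    using prime[OF irr a(1) \<open>a \<noteq> \<zero>\<close> b(1) \<open>b \<noteq> \<zero>\<close>] by blast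
  \<comment> \<open>\<open>aR\<close> and \<open>bR\<close> avoid the domain and the range of the graph \<open>kR\<close>, which \<open>c + d\<close> therefore extends.\<close>
  define c where "c = a \<otimes> (r \<otimes> b)"
  have c: "c \<in> carrier R" "e \<otimes> c = c" "x \<otimes> c = \<zero>" "c \<noteq> \<zero>"
    using a b r x e(1) by (simp_all add: c_def mult_left_cong[OF a(2)] mult_left_cong[OF a(3)])
  obtain w where w: "w \<in> carrier R" "c \<otimes> (w \<otimes> c) = c"
    using quasi_inverseE c by blast
  \<comment> \<open>With this choice \<open>a \<otimes> r\<close> carries \<open>d\<close> back to
    \<open>c\<close>, so \<open>c \<otimes> z\<close> and \<open>d \<otimes> z\<close> vanish
    together. The graph pairing them is \<open>gR\<close> for
    \<open>g = c \<oplus> d\<close>.\<close>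
  define d where "d = b \<otimes> (w \<otimes> c)"
  have d: "d \<in> carrier R" "f \<otimes> d = d" "y \<otimes> d = \<zero>" "a \<otimes> (r \<otimes> d) = c"
    using b w c(1) a(1) r(1) y(1) f(1)
    by (simp_all add: d_def mult_left_cong[OF b(2)] mult_left_cong[OF b(3)]) (simp add: c_def m_assoc)
  have cd: "c \<otimes> z = \<zero> \<longleftrightarrow> d \<otimes> z = \<zero>" if "z \<in> carrier R" for z
  proof
    assume "c \<otimes> z = \<zero>"
    then show "d \<otimes> z = \<zero>"
      using that b(1) w(1) c(1) by (simp add: d_def m_assoc)
  next
    assume "d \<otimes> z = \<zero>"
    then have "a \<otimes> (r \<otimes> (d \<otimes> z)) = \<zero>"
      using a r by simp
    then show "c \<otimes> z = \<zero>"
      using d(4) that a(1) r(1) d(1) by (metis m_assoc m_closed)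
  qed
  define g where "g = c \<oplus> d"
  have ed: "e \<otimes> d = \<zero>" "f \<otimes> c = \<zero>"
    using e(1) f(1) c d ef by (metis m_assoc l_null)+
  have g: "g \<in> carrier R" "e \<otimes> g = c" "f \<otimes> g = d"
    using e f c d ed by (simp_all add: g_def r_distr)
  \<comment> \<open>The extended graph \<open>kR + gR\<close> has to be principal again; the
    idempotent \<open>h\<close> obtained next generates it.\<close>
  then have sum_g: "(e \<oplus> f) \<otimes> g = g"
    using e f by (simp add: l_distr g_def)
  obtain h p q where h: "h \<in> carrier R" "h \<otimes> k = k" "h \<otimes> g = g"
    "p \<in> carrier R" "q \<in> carrier R" "h = k \<otimes> p \<oplus> g \<otimes> q"
  proof (rule orthogonal_cover[OF k(1) g(1)])
    fix e' g' p r s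
    assume H: "e' \<in> carrier R" "g' \<in> carrier R" "(e' \<oplus> g') \<otimes> k = k" "(e' \<oplus> g') \<otimes> g = g"
      "p \<in> carrier R" "e' = k \<otimes> p" "s \<in> carrier R" "g' = g \<otimes> s \<ominus> k \<otimes> (p \<otimes> (g \<otimes> s))"
    have "e' \<oplus> g' = k \<otimes> (p \<ominus> p \<otimes> (g \<otimes> s)) \<oplus> g \<otimes> s"
      using H k(1) g(1) by (simp add: r_distr r_minus a_minus_def a_ac)
    then show thesis
      using H k(1) g(1) by (intro that[of "e' \<oplus> g'" "p \<ominus> p \<otimes> (g \<otimes> s)" s]) auto
  qed
  have sum_h: "(e \<oplus> f) \<otimes> h = h"
    using h k(1) g(1) sum(1) by (simp add: r_distr mult_left_cong[OF sum_k] mult_left_cong[OF sum_g])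
  have he: "z = \<zero>" if z: "z \<in> rideal h" "z \<in> rideal e" for z
  proof -
    obtain m where m: "m \<in> carrier R" "z = h \<otimes> m"
      using z mem_principal_right_ideal by blast
    define s t where "s = p \<otimes> m" and "t = q \<otimes> m"
    have st: "s \<in> carrier R" "t \<in> carrier R" "z = k \<otimes> s \<oplus> g \<otimes> t"
      using m h k(1) g(1) by (simp_all add: s_def t_def l_distr m_assoc)
    have "f \<otimes> z = \<zero>"
      using z mem_e ef f(1) e(1) by (metis m_assoc l_null)
    then have *: "f \<otimes> (k \<otimes> s) \<oplus> d \<otimes> t = \<zero>"
      using st f(1) k(1) g by (simp add: r_distr mult_left_cong[OF g(3)])
    \<comment> \<open>\<open>y\<close> fixes the old summand and kills the new one, so both summands
      vanish separately.\<close>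
    then have "y \<otimes> (f \<otimes> (k \<otimes> s) \<oplus> d \<otimes> t) = \<zero>"
      using y(1) by simp
    moreover have "y \<otimes> (f \<otimes> (k \<otimes> s)) = f \<otimes> (k \<otimes> s)"
      using y f(1) k(1) st(1) by (metis m_assoc m_closed)
    ultimately have fk: "f \<otimes> (k \<otimes> s) = \<zero>"
      using y f(1) k(1) st d by (simp add: r_distr mult_left_cong[OF d(3)])
    then have "d \<otimes> t = \<zero>"
      using * d(1) st(2) by simp
    then show ?thesis
      using st inj_f[OF st(1) fk] cd[OF st(2)] c(1) d(1) by (simp add: g_def l_distr)
  qed
  have hf: "z = \<zero>" if z: "z \<in> rideal h" "z \<in> rideal f" for z
  proof -
    obtain m where m: "m \<in> carrier R" "z = h \<otimes> m"
      using z mem_principal_right_ideal by blast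
    define s t where "s = p \<otimes> m" and "t = q \<otimes> m"
    have st: "s \<in> carrier R" "t \<in> carrier R" "z = k \<otimes> s \<oplus> g \<otimes> t"
      using m h k(1) g(1) by (simp_all add: s_def t_def l_distr m_assoc)
    have "e \<otimes> z = \<zero>"
      using z mem_f ef f(1) e(1) by (metis m_assoc l_null)
    then have *: "e \<otimes> (k \<otimes> s) \<oplus> c \<otimes> t = \<zero>"
      using st e(1) k(1) g by (simp add: r_distr mult_left_cong[OF g(2)])
    then have "x \<otimes> (e \<otimes> (k \<otimes> s) \<oplus> c \<otimes> t) = \<zero>"
      using x(1) by simp
    moreover have "x \<otimes> (e \<otimes> (k \<otimes> s)) = e \<otimes> (k \<otimes> s)"
      using x e(1) k(1) st(1) by (metis m_assoc m_closed)
    ultimately have ek: "e \<otimes> (k \<otimes> s) = \<zero>"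
      using x e(1) k(1) st c by (simp add: r_distr mult_left_cong[OF c(3)])
    then have "c \<otimes> t = \<zero>"
      using * c(1) st(2) by simp
    then show ?thesis
      using st inj_e[OF st(1) ek] cd[OF st(2)] c(1) d(1) by (simp add: g_def l_distr)
  qed
  have "rideal h \<in> P"
  proof -
    have "\<zero> \<in> rideal z" if "z \<in> carrier R" for z
      using that mem_principal_right_ideal by (metis r_null zero_closed)
    moreover have "rideal h \<subseteq> rideal (e \<oplus> f)"
      using sum_h h(1) sum by (simp add: rideal_subset_iff mem_sum)
    ultimately show ?thesis
      using he hf h(1) e(1) f(1) unfolding P_def principal_right_ideals_def by blast
  qed
  moreover have "K \<subseteq> rideal h"
    using h k mem_principal_right_ideal by (metis rideal_subset_iff)
  ultimately have "rideal h = rideal k"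
    using K(2) k by blast
  moreover have "g \<in> rideal h"
    using h g(1) mem_principal_right_ideal by metis
  ultimately obtain m where m: "m \<in> carrier R" "g = k \<otimes> m"
    using mem_principal_right_ideal by auto
  \<comment> \<open>If \<open>g\<close> already lay in \<open>kR\<close>, then
    \<open>c = e \<otimes> g\<close> would lie in the old domain, which \<open>x\<close> fixes; but
    \<open>x\<close> kills \<open>c\<close>, and \<open>c\<close> is non-zero.\<close>
  then have "c = x \<otimes> c"
    using g(2) x e(1) k(1) by (metis m_assoc m_closed)
  then show False
    using c by simp
qed

end

text \<open>The idempotents can be replaced without changing their right ideals: \<open>n\<close>
  generates \<open>fR\<close>, \<open>d\<close> generates \<open>eR\<close>, and these two are
  orthogonal.\<close>

lemma (in unital_continuous_ring) comparable_disjoint: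
  assumes irr: "irreducible_ring R"
    and e: "e \<in> carrier R" "e \<otimes> e = e" and f: "f \<in> carrier R" "f \<otimes> f = f"
    and disjoint: "\<And>z. \<lbrakk>z \<in> carrier R; e \<otimes> z = z; f \<otimes> z = z\<rbrakk> \<Longrightarrow> z = \<zero>"
  shows "subequivalent e f \<or> subequivalent f e"
proof -
  obtain n where n: "n \<in> carrier R" "n \<otimes> n = n" "n \<otimes> f = f" "f \<otimes> n = n" "n \<otimes> e = \<zero>"
    using idempotent_complement[OF e f disjoint] by blast
  define d where "d = e \<ominus> e \<otimes> n"
  have nd: "n \<otimes> d = \<zero>" "d \<otimes> n = \<zero>" "d \<otimes> e = e"
    using e n mult_left_cong[OF n(5)] by (simp_all add: d_def diff_mult_distrib m_assoc)
  have d: "d \<in> carrier R" "e \<otimes> d = d"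
    using e n mult_left_cong[OF e(2)] by (simp_all add: d_def diff_mult_distrib)
  have "d \<otimes> d = d"
    using nd d e by (metis m_assoc)
  then have "subequivalent d n \<or> subequivalent n d"
    using comparable_orthogonal[OF irr] d n nd by blast
  moreover have "subequivalent e d" "subequivalent d e" "subequivalent f n" "subequivalent n f"
    using subequivalent_mult_left nd d n e f by simp_all
  ultimately show ?thesis
    using subequivalent_trans e(1) f(1) d(1) n(1) by blast
qed

text \<open>Split off \<open>eR \<inter> fR\<close>, compare the complements, and extend the
  comparison by the identity on the common part.\<close>

lemma (in unital_continuous_ring) comparable:
  assumes irr: "irreducible_ring R"
    and e: "e \<in> carrier R" "e \<otimes> e = e" and f: "f \<in> carrier R" "f \<otimes> f = f"
  shows "subequivalent e f \<or> subequivalent f e"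
proof -
  define w where "w = e \<ominus> f \<otimes> e"
  have w: "w \<in> carrier R" "w \<otimes> e = w"
    using e f by (simp_all add: w_def diff_mult_distrib m_assoc)
  obtain v where v: "v \<in> carrier R" "w \<otimes> (v \<otimes> w) = w"
    using quasi_inverseE w by blast
  \<comment> \<open>\<open>d\<close> projects onto \<open>eR \<inter> fR\<close>, and \<open>c\<close>, \<open>c'\<close> onto complements of it in \<open>eR\<close> and \<open>fR\<close>.\<close>
  define d where "d = e \<ominus> e \<otimes> (v \<otimes> w)"
  define c where "c = e \<ominus> d"
  define c' where "c' = f \<ominus> d \<otimes> f"
  have d: "d \<in> carrier R" "e \<otimes> d = d" "d \<otimes> e = d"
    using e v w mult_left_cong[OF e(2)] by (simp_all add: d_def diff_mult_distrib m_assoc)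
  have wd: "w \<otimes> d = \<zero>"
    using e v w mult_left_cong[OF w(2)] by (simp add: d_def diff_mult_distrib)
  then have "d \<ominus> f \<otimes> d = \<zero>"
    using d e f by (simp add: w_def diff_mult_distrib m_assoc)
  then have fd: "f \<otimes> d = d"
    using d f by simp
  have dd: "d \<otimes> d = d"
  proof -
    have "d \<otimes> d = e \<otimes> d \<ominus> e \<otimes> (v \<otimes> (w \<otimes> d))"
      using d(1) e v w by (subst (1) d_def) (simp add: diff_mult_distrib m_assoc)
    then show ?thesis
      using d e v wd by simp
  qed
  have c: "c \<in> carrier R" "e \<otimes> c = c" "c \<otimes> e = c" "c \<otimes> c = c" "c \<otimes> d = \<zero>" "d \<otimes> c = \<zero>" "e = d \<oplus> c"
    using d e dd by (simp_all add: c_def diff_mult_distrib add_diff_cancel)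
  have c': "c' \<in> carrier R" "f \<otimes> c' = c'" "c' \<otimes> f = c'" "c' \<otimes> c' = c'" "c' \<otimes> d = \<zero>" "d \<otimes> c' = \<zero>"
    "f = d \<otimes> f \<oplus> c'"
    using d f fd dd mult_left_cong[OF fd] mult_left_cong[OF dd]
    by (simp_all add: c'_def diff_mult_distrib add_diff_cancel m_assoc)
  have "z = \<zero>" if z: "z \<in> carrier R" "c \<otimes> z = z" "c' \<otimes> z = z" for z
  proof -
    have "e \<otimes> z = z" "f \<otimes> z = z"
      using z c c' e f by (metis m_assoc)+
    then have "w \<otimes> z = \<zero>"
      using e f z by (simp add: w_def diff_mult_distrib m_assoc)
    then have "d \<otimes> z = z"
      using \<open>e \<otimes> z = z\<close> e v w z by (simp add: d_def diff_mult_distrib m_assoc)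
    then show ?thesis
      using z c d by (metis m_assoc l_null)
  qed
  then have "subequivalent c c' \<or> subequivalent c' c"
    using comparable_disjoint[OF irr] c c' by blast
  then show ?thesis
  proof
    assume "subequivalent c c'"
    then obtain t s where ts: "t \<in> carrier R" "s \<in> carrier R" "c = t \<otimes> (c' \<otimes> s)"
      by (auto simp: subequivalent_def)
    have "(d \<oplus> c \<otimes> (t \<otimes> c')) \<otimes> (f \<otimes> (d \<oplus> c' \<otimes> (s \<otimes> c))) = d \<oplus> c \<otimes> (t \<otimes> (c' \<otimes> s) \<otimes> c)"
      using c c' d fd dd f ts(1,2) mult_left_cong[OF c'(2)] mult_left_cong[OF c'(4)] mult_left_cong[OF c'(6)]
      by (simp add: l_distr r_distr m_assoc)
    also have "\<dots> = e"
      using ts(3) c by simp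
    finally have "subequivalent e f"
      using c c' d ts by (intro subequivalentI[of e "d \<oplus> c \<otimes> (t \<otimes> c')" f "d \<oplus> c' \<otimes> (s \<otimes> c)"]) auto
    then show ?thesis by blast
  next
    assume "subequivalent c' c"
    then obtain t s where ts: "t \<in> carrier R" "s \<in> carrier R" "c' = t \<otimes> (c \<otimes> s)"
      by (auto simp: subequivalent_def)
    \<comment> \<open>The asymmetry with the first case comes from the decompositions
      \<open>e = d \<oplus> c\<close> and \<open>f = d \<otimes> f \<oplus> c'\<close>:
      \<open>d\<close> absorbs \<open>e\<close> on the right, which is not known for
      \<open>f\<close>.\<close>
    have "(d \<oplus> c' \<otimes> (t \<otimes> c)) \<otimes> (e \<otimes> (d \<otimes> f \<oplus> c \<otimes> (s \<otimes> c'))) = d \<otimes> f \<oplus> c' \<otimes> (t \<otimes> (c \<otimes> s) \<otimes> c')"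
      using c(1-6) c' d dd f e(1) ts(1,2) mult_left_cong[OF c(2)] mult_left_cong[OF c(4)] mult_left_cong[OF c(5)]
        mult_left_cong[OF c(6)] mult_left_cong[OF d(2)] mult_left_cong[OF dd]
      by (simp add: l_distr r_distr m_assoc)
    also have "\<dots> = f"
      using ts(3) c' by simp
    finally have "subequivalent f e"
      using c c' d f ts by (intro subequivalentI[of f "d \<oplus> c' \<otimes> (t \<otimes> c)" e "d \<otimes> f \<oplus> c \<otimes> (s \<otimes> c')"]) auto
    then show ?thesis by blast
  qed
qed

subsection \<open>The rank function\<close>

locale ranked_continuous_ring = unital_continuous_ring +
  fixes \<rho> :: "'a \<Rightarrow> real"
  assumes irreducible: "irreducible_ring R"
    and rank: "rank_function R \<rho>"
begin

lemma rank_mult_left: "\<lbrakk>a \<in> carrier R; b \<in> carrier R\<rbrakk> \<Longrightarrow> \<rho> (a \<otimes> b) \<le> \<rho> a"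
  and rank_mult_right: "\<lbrakk>a \<in> carrier R; b \<in> carrier R\<rbrakk> \<Longrightarrow> \<rho> (a \<otimes> b) \<le> \<rho> b"
  and rank_add_orthogonal:
    "\<lbrakk>e \<in> carrier R; f \<in> carrier R; e \<otimes> e = e; f \<otimes> f = f; e \<otimes> f = \<zero>; f \<otimes> e = \<zero>\<rbrakk>
      \<Longrightarrow> \<rho> (e \<oplus> f) = \<rho> e + \<rho> f"
  and rank_one: "\<rho> \<one> = 1"
  and rank_nonneg: "a \<in> carrier R \<Longrightarrow> 0 \<le> \<rho> a"
  and rank_zero_imp: "\<lbrakk>a \<in> carrier R; \<rho> a = 0\<rbrakk> \<Longrightarrow> a = \<zero>"
  using rank by (auto simp: rank_function_def PiE_iff)

lemma rank_zero: "\<rho> \<zero> = 0"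
  using rank_add_orthogonal[of \<zero> \<zero>] by simp

lemma rank_uminus: "a \<in> carrier R \<Longrightarrow> \<rho> (\<ominus> a) = \<rho> a"
  using rank_mult_right[of "\<ominus> \<one>" a] rank_mult_right[of "\<ominus> \<one>" "\<ominus> a"] by (simp add: l_minus)

lemma rank_mult_middle:
  "\<lbrakk>a \<in> carrier R; b \<in> carrier R; c \<in> carrier R\<rbrakk> \<Longrightarrow> \<rho> (a \<otimes> (b \<otimes> c)) \<le> \<rho> b"
  using rank_mult_right[of a "b \<otimes> c"] rank_mult_left[of b c] by simp

text \<open>Additivity is given for orthogonal idempotents only. An orthogonal cover of
  \<open>a\<close> and \<open>b\<close> fixes \<open>a \<oplus> b\<close> from the left, and its two
  parts have rank at most that of \<open>a\<close> and of \<open>b\<close>.\<close>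

lemma rank_add_le:
  assumes "a \<in> carrier R" "b \<in> carrier R"
  shows "\<rho> (a \<oplus> b) \<le> \<rho> a + \<rho> b"
proof (rule orthogonal_cover[OF assms])
  fix e g p r s
  assume e: "e \<in> carrier R" "g \<in> carrier R" "e \<otimes> e = e" "g \<otimes> g = g" "e \<otimes> g = \<zero>" "g \<otimes> e = \<zero>"
    "(e \<oplus> g) \<otimes> a = a" "(e \<oplus> g) \<otimes> b = b"
    and p: "p \<in> carrier R" "e = a \<otimes> p" "r \<in> carrier R" "s \<in> carrier R" "g = r \<otimes> (b \<otimes> s)"
  have "a \<oplus> b = (e \<oplus> g) \<otimes> (a \<oplus> b)"
    using e assms by (simp add: r_distr)
  then have "\<rho> (a \<oplus> b) \<le> \<rho> (e \<oplus> g)"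
    using rank_mult_left[of "e \<oplus> g" "a \<oplus> b"] e assms by simp
  also have "\<dots> = \<rho> e + \<rho> g"
    using e rank_add_orthogonal by blast
  also have "\<dots> \<le> \<rho> a + \<rho> b"
    using p assms rank_mult_left[of a p] rank_mult_middle[of r b s] by simp
  finally show ?thesis .
qed

lemma rank_diff_le:
  "\<lbrakk>a \<in> carrier R; b \<in> carrier R\<rbrakk> \<Longrightarrow> \<rho> (a \<ominus> b) \<le> \<rho> a + \<rho> b"
  using rank_add_le[of a "\<ominus> b"] by (simp add: a_minus_def rank_uminus)

lemma rank_diff_idempotent:
  assumes "e \<in> carrier R" "f \<in> carrier R" "e \<otimes> e = e" "f \<otimes> f = f" "e \<otimes> f = f" "f \<otimes> e = f"
  shows "\<rho> (e \<ominus> f) = \<rho> e - \<rho> f"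
proof -
  have "\<rho> (f \<oplus> (e \<ominus> f)) = \<rho> f + \<rho> (e \<ominus> f)"
    by (rule rank_add_orthogonal) (use assms in \<open>simp_all add: diff_mult_distrib\<close>)
  then show ?thesis
    using assms by (simp add: add_diff_cancel)
qed

text \<open>By comparability one of the two embeds in the other, say \<open>e\<close> in
  \<open>f\<close>. The image idempotent \<open>g\<close> below \<open>f\<close> has full rank, so
  \<open>f \<ominus> g\<close> has rank zero and vanishes.\<close>

lemma idempotents_equal_rank_isomorphic:
  assumes e: "e \<in> carrier R" "e \<otimes> e = e" and f: "f \<in> carrier R" "f \<otimes> f = f"
    and eq: "\<rho> e = \<rho> f"
  obtains s t where "s \<in> carrier R" "t \<in> carrier R" "s \<otimes> e = s" "f \<otimes> s = s" "t \<otimes> f = t" "e \<otimes> t = t"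
    "t \<otimes> s = e" "s \<otimes> t = f"
proof -
  have iso: "\<exists>s\<in>carrier R. \<exists>t\<in>carrier R. s \<otimes> e = s \<and> f \<otimes> s = s \<and> t \<otimes> f = t \<and> e \<otimes> t = t \<and> t \<otimes> s = e \<and> s \<otimes> t = f"
    if e: "e \<in> carrier R" "e \<otimes> e = e" and f: "f \<in> carrier R" "f \<otimes> f = f"
    and eq: "\<rho> e = \<rho> f" and sub: "subequivalent e f" for e f
  proof -
    obtain x y where xy: "x \<in> carrier R" "y \<in> carrier R" "e = x \<otimes> (f \<otimes> y)"
      using sub by (auto simp: subequivalent_def)
    define s where "s = f \<otimes> (y \<otimes> e)"
    define t where "t = e \<otimes> (x \<otimes> f)"
    have st: "s \<in> carrier R" "t \<in> carrier R" "s \<otimes> e = s" "f \<otimes> s = s" "t \<otimes> f = t" "e \<otimes> t = t"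
      using e f xy(1,2) mult_left_cong[OF e(2)] mult_left_cong[OF f(2)]
      by (simp_all add: s_def t_def m_assoc)
    have "t \<otimes> s = e \<otimes> (x \<otimes> (f \<otimes> y) \<otimes> e)"
      using e(1) f xy(1,2) mult_left_cong[OF f(2)] by (simp add: s_def t_def m_assoc)
    then have ts: "t \<otimes> s = e"
      using e xy(3) by simp
    define g where "g = s \<otimes> t"
    have g: "g \<in> carrier R" "g \<otimes> g = g" "f \<otimes> g = g" "g \<otimes> f = g"
      using st f e mult_left_cong[OF ts] mult_left_cong[OF st(4)] by (simp_all add: g_def m_assoc)
    have "e = t \<otimes> (g \<otimes> s)"
      using st e ts by (simp add: g_def m_assoc)
    then have "\<rho> e \<le> \<rho> g"
      using rank_mult_middle[of t g s] st g by simp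
    then have "\<rho> (f \<ominus> g) = 0"
      using rank_diff_idempotent[of f g] rank_nonneg[of "f \<ominus> g"] f g eq by simp
    then have "s \<otimes> t = f"
      using rank_zero_imp[of "f \<ominus> g"] f g by (simp add: g_def)
    then show ?thesis
      using st ts by blast
  qed
  show thesis
    using comparable[OF irreducible e f] iso[OF e f eq] iso[OF f e eq[symmetric]] that by blast
qed

end

section \<open>The rank metric\<close>

lemma (in ring) diff_add_diff:
  "\<lbrakk>a \<in> carrier R; b \<in> carrier R; c \<in> carrier R\<rbrakk> \<Longrightarrow> (a \<ominus> b) \<oplus> (b \<ominus> c) = a \<ominus> c"
  by algebra

lemma (in ring) add_diff_self:
  "\<lbrakk>a \<in> carrier R; b \<in> carrier R\<rbrakk> \<Longrightarrow> (a \<oplus> b) \<ominus> a = b"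
  by algebra

context ranked_continuous_ring
begin

lemma rank_minus_commute:
  assumes "a \<in> carrier R" "b \<in> carrier R"
  shows "\<rho> (a \<ominus> b) = \<rho> (b \<ominus> a)"
proof -
  have "a \<ominus> b = \<ominus> (b \<ominus> a)"
    using assms by (simp add: a_minus_def minus_add a_comm)
  then show ?thesis
    using assms by (simp add: rank_uminus)
qed

lemma rank_diff_triangle:
  assumes "a \<in> carrier R" "b \<in> carrier R" "c \<in> carrier R"
  shows "\<rho> (a \<ominus> c) \<le> \<rho> (a \<ominus> b) + \<rho> (b \<ominus> c)"
  using rank_add_le[of "a \<ominus> b" "b \<ominus> c"] assms by (simp add: diff_add_diff)

lemma rank_pow_minus_one_le:
  assumes x: "x \<in> carrier R"
  shows "\<rho> (x [^] (k::nat) \<ominus> \<one>) \<le> \<rho> (x \<ominus> \<one>)"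
proof -
  have "\<exists>c\<in>carrier R. x [^] k \<ominus> \<one> = c \<otimes> (x \<ominus> \<one>)"
  proof (induction k)
    case 0
    then show ?case
      using x by (intro bexI[of _ \<zero>]) auto
  next
    case (Suc k)
    then obtain c where c: "c \<in> carrier R" "x [^] k \<ominus> \<one> = c \<otimes> (x \<ominus> \<one>)"
      by blast
    have "x [^] Suc k \<ominus> \<one> = x [^] k \<otimes> (x \<ominus> \<one>) \<oplus> (x [^] k \<ominus> \<one>)"
      using x by (simp add: diff_mult_distrib diff_add_diff)
    also have "\<dots> = (x [^] k \<oplus> c) \<otimes> (x \<ominus> \<one>)"
      using x c by (simp add: l_distr)
    finally show ?case
      using x c by blast
  qed
  then show ?thesis
    using rank_mult_right x by auto
qed

lemma rank_quasi_inverse: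
  assumes "a \<in> carrier R" "b \<in> carrier R" "a \<otimes> (b \<otimes> a) = a"
  shows "\<rho> (a \<otimes> b) = \<rho> a" "\<rho> (b \<otimes> a) = \<rho> a"
  using rank_mult_left[of a b] rank_mult_right[of b a] rank_mult_left[of "a \<otimes> b" a]
    rank_mult_right[of a "b \<otimes> a"] assms
  by (auto simp: m_assoc)

subsection \<open>Generation of the unit group by a ball\<close>

text \<open>The rank rules out that \<open>r\<close> is subequivalent to \<open>e\<close>, so
  \<open>e = t r s\<close> by comparability. The copy of \<open>e\<close> inside \<open>r\<close> is
  \<open>d = r s e t r\<close>.\<close>

lemma subidempotent_of_rank:
  assumes e: "e \<in> carrier R" "e \<otimes> e = e" and r: "r \<in> carrier R" "r \<otimes> r = r"
    and less: "\<rho> e < \<rho> r"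
  obtains d where "d \<in> carrier R" "d \<otimes> d = d" "r \<otimes> d = d" "d \<otimes> r = d" "\<rho> d = \<rho> e"
proof -
  have "\<not> subequivalent r e"
  proof
    assume "subequivalent r e"
    then have "\<rho> r \<le> \<rho> e"
      using rank_mult_middle e(1) by (auto simp: subequivalent_def)
    then show False using less by simp
  qed
  then obtain t s where ts: "t \<in> carrier R" "s \<in> carrier R" "e = t \<otimes> (r \<otimes> s)"
    using comparable[OF irreducible e r] by (auto simp: subequivalent_def)
  define d where "d = r \<otimes> (s \<otimes> (e \<otimes> (t \<otimes> r)))"
  have d: "d \<in> carrier R" "r \<otimes> d = d" "d \<otimes> r = d"
    using r e(1) ts(1,2) mult_left_cong[OF r(2)] by (simp_all add: d_def m_assoc)
  have "d \<otimes> d = r \<otimes> (s \<otimes> (e \<otimes> (t \<otimes> (r \<otimes> s) \<otimes> (e \<otimes> (t \<otimes> r)))))"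
    using r e(1) ts(1,2) mult_left_cong[OF r(2)] by (simp add: d_def m_assoc)
  also have "\<dots> = d"
    using r e ts(1,2) mult_left_cong[OF e(2)] by (simp add: d_def flip: ts(3))
  finally have dd: "d \<otimes> d = d" .
  have "t \<otimes> (d \<otimes> s) = t \<otimes> (r \<otimes> s) \<otimes> (e \<otimes> (t \<otimes> (r \<otimes> s)))"
    using r e(1) ts(1,2) by (simp add: d_def m_assoc)
  also have "\<dots> = e"
    using e by (simp flip: ts(3))
  finally have "\<rho> e \<le> \<rho> d"
    using rank_mult_middle[of t d s] ts(1,2) d by simp
  moreover have "\<rho> d \<le> \<rho> e"
    using rank_mult_middle[of "r \<otimes> s" e "t \<otimes> r"] r(1) e(1) ts(1,2) by (simp add: d_def m_assoc)
  ultimately show thesis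
    using that d dd by simp
qed

text \<open>If \<open>qR\<close> meets the kernel of \<open>u\<close> trivially, then a map \<open>s\<close> that carries the kernel onto a complement
  of \<open>uR\<close> and kills \<open>q\<close> turns \<open>u\<close> into a unit without changing it on \<open>qR\<close>.\<close>

lemma extend_to_unit:
  assumes u: "u \<in> carrier R" and q: "q \<in> carrier R" "q \<otimes> q = q"
    and inj: "\<And>z. \<lbrakk>z \<in> carrier R; q \<otimes> z = z; u \<otimes> z = \<zero>\<rbrakk> \<Longrightarrow> z = \<zero>"
  obtains s where "s \<in> carrier R" "s \<otimes> q = \<zero>" "u \<oplus> s \<in> Units R" "\<rho> s \<le> 1 - \<rho> u"
proof -
  obtain v where v: "v \<in> carrier R" "u \<otimes> (v \<otimes> u) = u"
    using quasi_inverseE u by blast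
  define k where "k = \<one> \<ominus> v \<otimes> u"
  define m where "m = u \<otimes> v"
  define l where "l = \<one> \<ominus> m"
  have k: "k \<in> carrier R" "k \<otimes> k = k" "u \<otimes> k = \<zero>"
    using u v by (simp_all add: k_def diff_mult_distrib m_assoc)
  have m: "m \<in> carrier R" "m \<otimes> m = m" "m \<otimes> u = u"
    using u v mult_left_cong[OF v(2)] by (simp_all add: m_def m_assoc)
  have l: "l \<in> carrier R" "l \<otimes> l = l" "m \<otimes> l = \<zero>" "l \<otimes> u = \<zero>" "m \<oplus> l = \<one>"
    using m u by (simp_all add: l_def diff_mult_distrib add_diff_cancel)
  have "z = \<zero>" if "z \<in> carrier R" "q \<otimes> z = z" "k \<otimes> z = z" for z
    using inj that k(1,3) u by (metis l_null m_assoc)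
  \<comment> \<open>\<open>n\<close> is another projection onto the kernel of \<open>u\<close>,
    chosen to kill \<open>q\<close>. It has the same rank as the complement \<open>l\<close> of the
    image, so the two are isomorphic via \<open>s\<close> and \<open>t\<close>.\<close>
  then obtain n where n: "n \<in> carrier R" "n \<otimes> n = n" "n \<otimes> k = k" "k \<otimes> n = n" "n \<otimes> q = \<zero>"
    using idempotent_complement[OF q k(1,2)] by blast
  have un: "u \<otimes> n = \<zero>"
    using n u k by (metis l_null m_assoc)
  have "\<rho> (v \<otimes> u) = \<rho> u" "\<rho> m = \<rho> u"
    using rank_quasi_inverse[OF u v] by (simp_all add: m_def)
  then have "\<rho> k = 1 - \<rho> u" "\<rho> l = 1 - \<rho> u"
    using rank_diff_idempotent[of \<one> "v \<otimes> u"] rank_diff_idempotent[of \<one> m] u v m rank_one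
    by (simp_all add: k_def l_def m_assoc)
  moreover have "\<rho> n = \<rho> k"
    using rank_mult_left[of n k] rank_mult_left[of k n] n k by simp
  ultimately have rank_n: "\<rho> n = 1 - \<rho> u" "\<rho> n = \<rho> l"
    by simp_all
  obtain s t where st: "s \<in> carrier R" "t \<in> carrier R" "s \<otimes> n = s" "l \<otimes> s = s" "t \<otimes> l = t"
    "n \<otimes> t = t" "t \<otimes> s = n" "s \<otimes> t = l"
    using idempotents_equal_rank_isomorphic[OF n(1,2) l(1,2) rank_n(2)] by blast
  \<comment> \<open>The inverse of \<open>u \<oplus> s\<close>: on \<open>uR\<close> take the
    preimage under \<open>u\<close> without kernel component, and on \<open>lR\<close> undo
    \<open>s\<close> by \<open>t\<close>.\<close>
  define g where "g = (\<one> \<ominus> n) \<otimes> (v \<otimes> m) \<oplus> t"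
  have ut: "u \<otimes> t = \<zero>" and tu: "t \<otimes> u = \<zero>" and ms: "m \<otimes> s = \<zero>"
    using st un l m(1) n(1) u by (metis l_null r_null m_assoc)+
  have s1n: "s \<otimes> (\<one> \<ominus> n) = \<zero>"
    using st n by (simp add: diff_mult_distrib)
  have u1n: "u \<otimes> (\<one> \<ominus> n) = u"
    using un u n by (simp add: diff_mult_distrib)
  have g: "g \<in> carrier R"
    using n v m st by (simp add: g_def)
  have "u \<otimes> (v \<otimes> m) = m"
    using u v(1) m by (simp add: m_def m_assoc)
  then have "(u \<oplus> s) \<otimes> g = m \<oplus> l"
    using u v(1) m n(1) st(1,2,8) l(1) ut mult_left_cong[OF s1n] mult_left_cong[OF u1n]
    by (simp add: g_def l_distr r_distr)
  then have hg: "(u \<oplus> s) \<otimes> g = \<one>"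
    using l by simp
  have "(\<one> \<ominus> n) \<otimes> (v \<otimes> u) = \<one> \<ominus> n"
  proof -
    have "(\<one> \<ominus> n) \<otimes> k = \<zero>"
      using n k by (simp add: diff_mult_distrib)
    then have "(\<one> \<ominus> n) \<ominus> (\<one> \<ominus> n) \<otimes> (v \<otimes> u) = \<zero>"
      using n u v(1) by (simp add: k_def diff_mult_distrib(2))
    then show ?thesis
      using n u v(1) by simp
  qed
  moreover have "g \<otimes> (u \<oplus> s) = (\<one> \<ominus> n) \<otimes> (v \<otimes> u) \<oplus> n"
    using u v(1) m n(1) st(1,2,7) tu ms by (simp add: g_def l_distr r_distr m_assoc)
  ultimately have "g \<otimes> (u \<oplus> s) = \<one>"
    using n by (simp add: a_comm add_diff_cancel)
  then have "u \<oplus> s \<in> Units R"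
    using hg g u st unfolding Units_def by blast
  moreover have "s \<otimes> q = \<zero>"
    using st n q by (metis m_assoc r_null)
  moreover have "\<rho> s \<le> 1 - \<rho> u"
    using rank_mult_right[of s n] st n rank_n by simp
  ultimately show thesis
    using that st(1) by blast
qed

lemma unit_step:
  assumes x: "x \<in> Units R" and e: "e \<in> carrier R" "e \<otimes> e = e" and less: "\<rho> e < \<rho> (x \<ominus> \<one>)"
  obtains h where "h \<in> Units R" "\<rho> (h \<ominus> \<one>) \<le> 2 * \<rho> e" "\<rho> (inv h \<otimes> x \<ominus> \<one>) \<le> \<rho> (x \<ominus> \<one>) - \<rho> e"
proof -
  define a where "a = x \<ominus> \<one>"
  have a: "a \<in> carrier R" and xc: "x \<in> carrier R" and xa: "x = \<one> \<oplus> a"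
    using x by (auto simp: a_def add_diff_cancel)
  obtain b where b: "b \<in> carrier R" "a \<otimes> (b \<otimes> a) = a"
    using quasi_inverseE a by blast
  define r where "r = b \<otimes> a"
  have r: "r \<in> carrier R" "r \<otimes> r = r" "a \<otimes> r = a" "\<rho> r = \<rho> a"
    using a b rank_quasi_inverse[OF a b] by (simp_all add: r_def m_assoc)
  obtain d where d: "d \<in> carrier R" "d \<otimes> d = d" "r \<otimes> d = d" "d \<otimes> r = d" "\<rho> d = \<rho> e"
    using subidempotent_of_rank[OF e r(1,2)] less r(4) by (auto simp: a_def)
  \<comment> \<open>Since \<open>q = (1 - r) + d\<close>, it projects onto the sum of the kernel of
    \<open>a\<close> and \<open>dR\<close>; \<open>c\<close> is the part of the support still to be
    treated.\<close>
  define c where "c = r \<ominus> d"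
  define q where "q = \<one> \<ominus> c"
  have c: "c \<in> carrier R" "c \<otimes> c = c" "d \<otimes> c = \<zero>" "\<rho> c = \<rho> a - \<rho> e"
    using r d rank_diff_idempotent[of r d] by (simp_all add: c_def diff_mult_distrib)
  have q: "q \<in> carrier R" "q \<otimes> q = q" "d \<otimes> q = d"
    using c d by (simp_all add: q_def diff_mult_distrib)
  have "a \<otimes> c = a \<ominus> a \<otimes> d"
    using a r d by (simp add: c_def diff_mult_distrib)
  then have aq: "a \<otimes> q = a \<otimes> d"
    using a c(1) d(1) by (simp add: q_def diff_mult_distrib) (simp add: a_minus_def minus_add r_neg2)
  \<comment> \<open>\<open>u\<close> agrees with \<open>x\<close> on \<open>qR\<close> and differs
    from one by rank at most \<open>\<rho> e\<close>, but need not be a unit. Its rank defect is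
    therefore at most \<open>\<rho> e\<close> too, which bounds the correction
    \<open>s\<close>.\<close>
  define u where "u = \<one> \<oplus> a \<otimes> d"
  have u: "u \<in> carrier R" "u \<otimes> q = x \<otimes> q"
    using a d(1) q by (simp_all add: u_def xa l_distr m_assoc aq)
  have "z = \<zero>" if z: "z \<in> carrier R" "q \<otimes> z = z" "u \<otimes> z = \<zero>" for z
  proof -
    have "x \<otimes> z = \<zero>"
      using z u q(1) xc by (metis m_assoc)
    then have "inv x \<otimes> (x \<otimes> z) = \<zero>"
      using x by simp
    then show ?thesis
      using x xc z(1) by (simp flip: m_assoc)
  qed
  then obtain s where s: "s \<in> carrier R" "s \<otimes> q = \<zero>" "u \<oplus> s \<in> Units R" "\<rho> s \<le> 1 - \<rho> u"
    using extend_to_unit[OF u(1) q(1,2)] by blast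
  have ad: "\<rho> (a \<otimes> d) \<le> \<rho> e"
    using rank_mult_right[of a d] a d by simp
  have "\<one> = u \<ominus> a \<otimes> d"
    using a d(1) by (simp add: u_def a_minus_def a_assoc r_neg)
  then have "1 \<le> \<rho> u + \<rho> (a \<otimes> d)"
    using rank_diff_le[of u "a \<otimes> d"] rank_one u a d(1) by simp
  then have "\<rho> s \<le> \<rho> e"
    using s(4) ad by simp
  moreover have "(u \<oplus> s) \<ominus> \<one> = a \<otimes> d \<oplus> s"
    using a d(1) s(1) by (simp add: u_def a_assoc add_diff_self)
  ultimately have near: "\<rho> ((u \<oplus> s) \<ominus> \<one>) \<le> 2 * \<rho> e"
    using rank_add_le[of "a \<otimes> d" s] a d(1) s(1) ad by simp
  define y where "y = inv (u \<oplus> s) \<otimes> x"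
  have y: "y \<in> carrier R"
    using s(3) xc by (simp add: y_def)
  have "(u \<oplus> s) \<otimes> q = x \<otimes> q"
    using u s(1,2) q(1) by (simp add: l_distr xc)
  then have "y \<otimes> q = inv (u \<oplus> s) \<otimes> ((u \<oplus> s) \<otimes> q)"
    using s(3) xc q(1) by (simp add: y_def m_assoc)
  then have yq: "y \<otimes> q = q"
    using s(3) q(1) by (simp add: Units_closed flip: m_assoc)
  have "q \<oplus> c = \<one>"
    using c(1) by (simp add: q_def a_comm[of _ c] add_diff_cancel)
  \<comment> \<open>\<open>y\<close> fixes \<open>q\<close>, so \<open>y \<ominus> \<one>\<close>
    factors through \<open>c\<close>, whose rank is \<open>\<rho> a - \<rho> e\<close>.\<close>
  then have "y \<ominus> \<one> = (y \<ominus> \<one>) \<otimes> (q \<oplus> c)"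
    using y by simp
  also have "\<dots> = (y \<ominus> \<one>) \<otimes> c"
    using y yq q(1) c(1) by (simp add: r_distr diff_mult_distrib(1)[of y \<one> q])
  finally have "\<rho> (y \<ominus> \<one>) \<le> \<rho> a - \<rho> e"
    using rank_mult_right[of "y \<ominus> \<one>" c] y c by simp
  then show thesis
    using that[OF s(3) near] by (simp add: y_def a_def)
qed

text \<open>Writing \<open>x = h \<otimes> (inv h \<otimes> x)\<close> and using subadditivity, each
  induction step enlarges by \<open>\<rho> e\<close> the radius on which \<open>f\<close> vanishes.
  The bound \<open>2 * \<rho> e < \<delta>\<close> puts \<open>h\<close> in the initial
  ball.\<close>

lemma length_function_zero:
  assumes f: "length_function (GL R) f"
    and near: "\<And>x. x \<in> Units R \<Longrightarrow> \<rho> (x \<ominus> \<one>) < \<delta> \<Longrightarrow> f x = 0"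
    and e: "e \<in> carrier R" "e \<otimes> e = e" "0 < \<rho> e" "2 * \<rho> e < \<delta>"
    and x: "x \<in> Units R"
  shows "f x = 0"
proof -
  have "f x = 0" if "x \<in> Units R" "\<rho> (x \<ominus> \<one>) < \<delta> + real k * \<rho> e" for x k
    using that
  proof (induction k arbitrary: x)
    case 0
    then show ?case using near by simp
  next
    case (Suc k)
    show ?case
    proof (cases "\<rho> (x \<ominus> \<one>) < \<delta>")
      case True
      then show ?thesis using near Suc.prems by simp
    next
      case False
      then obtain h where h: "h \<in> Units R" "\<rho> (h \<ominus> \<one>) \<le> 2 * \<rho> e"
        "\<rho> (inv h \<otimes> x \<ominus> \<one>) \<le> \<rho> (x \<ominus> \<one>) - \<rho> e"
        using unit_step[of x e] Suc.prems(1) e by auto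
      have y: "inv h \<otimes> x \<in> Units R"
        using h Suc.prems(1) by simp
      have "f (inv h \<otimes> x) = 0"
        using Suc.IH[OF y] h(3) Suc.prems(2) by (simp add: algebra_simps)
      moreover have "f h = 0"
        using near h e by auto
      moreover have "x = h \<otimes> (inv h \<otimes> x)"
        using h(1) Suc.prems(1) by (simp add: Units_closed flip: m_assoc)
      moreover have "f (h \<otimes> (inv h \<otimes> x)) \<le> f h + f (inv h \<otimes> x)" "0 \<le> f x"
        using f h(1) y Suc.prems(1) by (simp_all add: length_function_def units_of_carrier units_of_mult)
      ultimately show ?thesis by simp
    qed
  qed
  moreover obtain k :: nat where "\<rho> (x \<ominus> \<one>) - \<delta> < real k * \<rho> e"
    using reals_Archimedean3[OF e(3)] by blast
  then have "\<rho> (x \<ominus> \<one>) < \<delta> + real k * \<rho> e"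
    by simp
  ultimately show ?thesis
    using x by blast
qed

end

subsection \<open>Escape functions\<close>

text \<open>The balls are given only as a subbase. The triangle inequality as sole metric assumption
  covers the rank metric and the zero distance alike.\<close>

lemma rank_topology_ball:
  assumes triangle: "\<And>a b c. \<lbrakk>a \<in> carrier R; b \<in> carrier R; c \<in> carrier R\<rbrakk> \<Longrightarrow>
      rank_dist R a c \<le> rank_dist R a b + rank_dist R b c"
    and "openin (rank_topology R) V" "x \<in> V"
  shows "\<exists>\<delta>>0. {b \<in> carrier R. rank_dist R x b < \<delta>} \<subseteq> V"
proof -
  have "generate_topology_on {{b \<in> carrier R. rank_dist R a b < \<epsilon>} | a \<epsilon>. a \<in> carrier R \<and> 0 < \<epsilon>} V"
    using assms(2) unfolding rank_topology_def by (rule openin_topology_generated_by)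
  then show ?thesis
    using \<open>x \<in> V\<close>
  proof (induction arbitrary: x)
    case (Int A B)
    obtain \<delta> where "0 < \<delta>" "{b \<in> carrier R. rank_dist R x b < \<delta>} \<subseteq> A"
      using Int.IH(1)[of x] Int.prems by auto
    moreover obtain \<epsilon> where "0 < \<epsilon>" "{b \<in> carrier R. rank_dist R x b < \<epsilon>} \<subseteq> B"
      using Int.IH(2)[of x] Int.prems by auto
    ultimately show ?case
      by (intro exI[of _ "min \<delta> \<epsilon>"]) auto
  next
    case (UN K)
    then obtain A where "A \<in> K" "x \<in> A"
      by blast
    then show ?case
      using UN.IH[of A x] by blast
  next
    case (Basis B)
    then obtain a \<epsilon> where a: "a \<in> carrier R" "B = {b \<in> carrier R. rank_dist R a b < \<epsilon>}"
      by blast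
    have "b \<in> B" if "b \<in> carrier R" "rank_dist R x b < \<epsilon> - rank_dist R a x" for b
      using triangle[of a x b] that a Basis by auto
    then show ?case
      using Basis a by (intro exI[of _ "\<epsilon> - rank_dist R a x"]) auto
  qed simp
qed

text \<open>A ball inside the escape neighbourhood contains all powers of each of its units, so the
  escape condition holds there for every \<open>n\<close>, hence for every
  \<open>\<epsilon>\<close>.\<close>

lemma (in ring) escape_function_vanishes_near_one:
  assumes triangle: "\<And>a b c. \<lbrakk>a \<in> carrier R; b \<in> carrier R; c \<in> carrier R\<rbrakk> \<Longrightarrow>
      rank_dist R a c \<le> rank_dist R a b + rank_dist R b c"
    and pow: "\<And>x k::nat. x \<in> carrier R \<Longrightarrow> rank_dist R \<one> (x [^] k) \<le> rank_dist R \<one> x"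
    and f: "escape_function (GL R) (GL_topology R) f"
  obtains \<delta> where "0 < \<delta>" "\<And>x. \<lbrakk>x \<in> Units R; rank_dist R \<one> x < \<delta>\<rbrakk> \<Longrightarrow> f x = 0"
proof -
  obtain U V where U: "openin (GL_topology R) V" "\<one> \<in> V" "V \<subseteq> U"
    and esc: "\<And>\<epsilon>. \<epsilon> > 0 \<Longrightarrow> \<exists>n::nat. \<forall>x\<in>Units R. (\<forall>k\<in>{1..n}. x [^]\<^bsub>GL R\<^esub> k \<in> U) \<longrightarrow> f x \<in> {0..<\<epsilon>}"
    using f by (auto simp: escape_function_def escape_neighbourhood_def units_of_carrier units_of_one)
  obtain W where W: "openin (rank_topology R) W" "V = W \<inter> Units R"
    using U(1) by (auto simp: GL_topology_def openin_subtopology)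
  obtain \<delta> where \<delta>: "0 < \<delta>" "{b \<in> carrier R. rank_dist R \<one> b < \<delta>} \<subseteq> W"
    using rank_topology_ball[OF triangle W(1), of \<one>] U(2) W(2) by auto
  have "f x = 0" if x: "x \<in> Units R" "rank_dist R \<one> x < \<delta>" for x
  proof -
    have "x [^]\<^bsub>GL R\<^esub> k \<in> U" for k :: nat
    proof -
      have "x [^] k \<in> W"
        using pow[of x k] Units_closed[OF x(1)] x(2) \<delta>(2) by auto
      moreover have "x [^]\<^bsub>GL R\<^esub> k = x [^] k" "x [^]\<^bsub>GL R\<^esub> k \<in> Units R"
        using x units_of_pow[of x k] group.is_monoid[OF units_group] monoid.nat_pow_closed[of "GL R" x k]
        by (auto simp: units_of_carrier)
      ultimately show ?thesis
        using U(3) W(2) by auto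
    qed
    then have "f x \<in> {0..<\<epsilon>}" if "\<epsilon> > 0" for \<epsilon>
      using esc[OF that] x(1) by blast
    \<comment> \<open>The first instance gives \<open>0 \<le> f x\<close>; if \<open>f x\<close>
      were positive, the second would give \<open>f x < f x\<close>.\<close>
    from this[of 1] this[of "f x"] show ?thesis
      by force
  qed
  then show thesis
    using that \<delta>(1) by blast
qed

lemma (in ranked_continuous_ring) escape_function_zero:
  assumes rk: "rk R = \<rho>" and nondiscrete: "nondiscrete_ring R"
    and f: "escape_function (GL R) (GL_topology R) f" and x: "x \<in> Units R"
  shows "f x = 0"
proof -
  have dist: "rank_dist R a b = \<rho> (a \<ominus> b)" for a b
    by (simp add: rank_dist_def rk)
  have dist_commute: "rank_dist R \<one> y = \<rho> (y \<ominus> \<one>)" if "y \<in> carrier R" for y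
    using rank_minus_commute that by (simp add: dist)
  obtain \<delta> where \<delta>: "0 < \<delta>" "\<And>x. \<lbrakk>x \<in> Units R; rank_dist R \<one> x < \<delta>\<rbrakk> \<Longrightarrow> f x = 0"
  proof (rule escape_function_vanishes_near_one[OF _ _ f])
    show "rank_dist R a c \<le> rank_dist R a b + rank_dist R b c"
      if "a \<in> carrier R" "b \<in> carrier R" "c \<in> carrier R" for a b c
      using rank_diff_triangle that by (simp add: dist)
    show "rank_dist R \<one> (y [^] k) \<le> rank_dist R \<one> y" if "y \<in> carrier R" for y and k :: nat
      using rank_pow_minus_one_le that by (simp add: dist_commute)
  qed (rule that)
  \<comment> \<open>Non-discreteness provides the step size: without such an \<open>a\<close>, all
    balls of radius \<open>\<delta> / 2\<close> would be singletons. The idempotent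
    \<open>a \<otimes> b\<close> then has the same rank as \<open>a\<close>.\<close>
  have "\<exists>a\<in>carrier R. a \<noteq> \<zero> \<and> 2 * \<rho> a < \<delta>"
  proof (rule ccontr)
    assume no: "\<not> ?thesis"
    have "openin (rank_topology R) {c}" if "c \<in> carrier R" for c
    proof -
      have "c = b" if "b \<in> carrier R" "rank_dist R c b < \<delta> / 2" for b
      proof (rule ccontr)
        assume "c \<noteq> b"
        then have "c \<ominus> b \<in> carrier R" "c \<ominus> b \<noteq> \<zero>"
          using that(1) \<open>c \<in> carrier R\<close> by simp_all
        then have "2 * rank_dist R c b \<ge> \<delta>"
          using no unfolding dist by (meson linorder_not_less)
        then show False using that by simp
      qed
      then have "{b \<in> carrier R. rank_dist R c b < \<delta> / 2} \<subseteq> {c}"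
        by blast
      moreover have "rank_dist R c c < \<delta> / 2"
        using \<open>c \<in> carrier R\<close> \<delta>(1) by (simp add: dist rank_zero)
      ultimately have "{c} = {b \<in> carrier R. rank_dist R c b < \<delta> / 2}"
        using \<open>c \<in> carrier R\<close> by blast
      moreover have "0 < \<delta> / 2"
        using \<delta>(1) by simp
      ultimately show ?thesis
        using \<open>c \<in> carrier R\<close> unfolding rank_topology_def
        by (intro topology_generated_by_Basis CollectI exI conjI)
    qed
    moreover have "topspace (rank_topology R) = carrier R"
    proof -
      have "c \<in> {b \<in> carrier R. rank_dist R c b < 1}" if "c \<in> carrier R" for c
        using that by (simp add: dist rank_zero)
      then have "carrier R \<subseteq> \<Union>{{b \<in> carrier R. rank_dist R a b < \<epsilon>} | a \<epsilon>. a \<in> carrier R \<and> 0 < \<epsilon>}"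
        using zero_less_one by blast
      then show ?thesis
        unfolding rank_topology_def topology_generated_by_topspace by blast
    qed
    ultimately have "rank_topology R = discrete_topology (carrier R)"
      using discrete_topology_unique by metis
    then show False
      using nondiscrete by (simp add: nondiscrete_ring_def)
  qed
  then obtain a where a: "a \<in> carrier R" "a \<noteq> \<zero>" "2 * \<rho> a < \<delta>"
    by blast
  obtain b where b: "b \<in> carrier R" "a \<otimes> (b \<otimes> a) = a"
    using quasi_inverseE a by blast
  have "\<rho> a > 0"
    using rank_nonneg[of a] rank_zero_imp[of a] a by fastforce
  moreover have "f y = 0" if "y \<in> Units R" "\<rho> (y \<ominus> \<one>) < \<delta>" for y
    using \<delta>(2)[OF that(1)] that dist_commute[of y] by (simp add: Units_closed)
  moreover have "a \<otimes> b \<otimes> (a \<otimes> b) = a \<otimes> b"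
    using a(1) b(1) mult_left_cong[OF b(2)] by (simp add: m_assoc)
  moreover have "length_function (GL R) f"
    using f by (simp add: escape_function_def)
  ultimately show ?thesis
    using length_function_zero[of f \<delta> "a \<otimes> b" x] x a b(1) rank_quasi_inverse(1)[OF a(1) b] by simp
qed

theorem corollary6p8:
  fixes R :: "('a, 'm) ring_scheme"
  assumes "continuous_ring R"
    and "irreducible_ring R"
    and "nondiscrete_ring R"
  shows "\<not> (\<exists>f. escape_function (GL R) (GL_topology R) f \<and> (\<exists>x\<in>carrier (GL R). f x \<noteq> 0))"
proof -
  interpret unital_continuous_ring R
    using assms(1) by unfold_locales
  have "f x = 0" if f: "escape_function (GL R) (GL_topology R) f" and x: "x \<in> Units R" for f x
  proof (cases "\<exists>!\<rho>. rank_function R \<rho>")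
    case False
    \<comment> \<open>Here \<open>rk\<close> takes its default value zero, so the ball of radius
      \<open>\<delta>\<close> contains every unit.\<close>
    then have trivial: "rank_dist R a b = 0" for a b
      unfolding rank_dist_def rk_def by (simp only: if_False)
    obtain \<delta> :: real where "0 < \<delta>" "\<And>y. \<lbrakk>y \<in> Units R; rank_dist R \<one>\<^bsub>R\<^esub> y < \<delta>\<rbrakk> \<Longrightarrow> f y = 0"
      by (rule escape_function_vanishes_near_one[OF _ _ f]) (simp add: trivial, simp add: trivial, rule that)
    then show ?thesis
      using x by (simp add: trivial)
  next
    case True
    then have "rank_function R (rk R)"
      using theI'[OF True] by (simp add: rk_def)
    then interpret ranked_continuous_ring R "rk R"
      using assms(2) by unfold_locales
    show ?thesis
      by (rule escape_function_zero[OF refl assms(3) f x])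
  qed
  then show ?thesis
    by (auto simp: units_of_carrier)
qed

end
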